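(* Let $K$ be an algebraically closed field of characteristic zero and let $C\subset\mathbb{P}^2(K)$ be a non-singular projective plane curve of degree $d\geq 4$. Then $Aut(C)$ contains an element of order $d(d-1)$ if and only if $C$ is projectively equivalent to $X^d+Y^d+\alpha XZ^{d-1}=0$ for some $\alpha\in K$, $\alpha\neq 0$. In particular, in this case $Aut(C)$ is cyclic of order $d(d-1)$ if $d\geq 5$.
   Context: $Aut(C)$ is the full automorphism group of $C$ over $K$, identified with the finite subgroup of $PGL_3(K)$ preserving the defining equation of $C$. *)

theory Defs
  imports
    "HOL-Analysis.Analysis"
    "HOL-Algebra.Algebra"
    "HOL-Computational_Algebra.Polynomial"
    "HOL-Library.Poly_Mapping"
begin

section \<open>Polynomials in three variables\<close>

text \<open>
  A polynomial in \<open>X, Y, Z\<close> is a finitely supported map from exponent vectors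
  to coefficients.  The variables \<open>X, Y, Z\<close> are indexed by \<open>1, 2, 3 :: 3\<close>
  (where \<open>3 = 0\<close> in this type).
\<close>

type_synonym 'a poly3 = "(3 \<Rightarrow>\<^sub>0 nat) \<Rightarrow>\<^sub>0 'a"

definition Const3 :: "'a \<Rightarrow> 'a::comm_ring_1 poly3" where
  "Const3 c = Poly_Mapping.single 0 c"

definition Var3 :: "3 \<Rightarrow> 'a::comm_ring_1 poly3" where
  "Var3 i = Poly_Mapping.single (Poly_Mapping.single i 1) 1"

definition homogeneous3 :: "nat \<Rightarrow> 'a::comm_ring_1 poly3 \<Rightarrow> bool" where
  "homogeneous3 d F \<longleftrightarrow>
     (\<forall>m \<in> Poly_Mapping.keys F. (\<Sum>i\<in>UNIV. Poly_Mapping.lookup m i) = d)"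

text \<open>Apply \<open>h\<close> to the coefficients and replace the \<open>i\<close>-th variable by \<open>v i\<close>.\<close>

definition insert3 :: "('a::comm_ring_1 \<Rightarrow> 'b::comm_ring_1) \<Rightarrow> (3 \<Rightarrow> 'b) \<Rightarrow> 'a poly3 \<Rightarrow> 'b" where
  "insert3 h v F =
     (\<Sum>m\<in>Poly_Mapping.keys F.
        h (Poly_Mapping.lookup F m) * (\<Prod>i\<in>UNIV. v i ^ Poly_Mapping.lookup m i))"

definition eval3 :: "'a::comm_ring_1 poly3 \<Rightarrow> 'a^3 \<Rightarrow> 'a" where
  "eval3 F x = insert3 (\<lambda>c. c) (\<lambda>i. x $ i) F"

text \<open>The polynomial \<open>F(A (X, Y, Z))\<close>.\<close>

definition linear_subst :: "'a::comm_ring_1^3^3 \<Rightarrow> 'a poly3 \<Rightarrow> 'a poly3" where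
  "linear_subst A F = insert3 Const3 (\<lambda>i. \<Sum>j\<in>UNIV. Const3 (A $ i $ j) * Var3 j) F"

text \<open>
  The truncated subtraction of exponents is harmless: where it truncates, the
  coefficient is \<open>0\<close>.
\<close>

definition partial3 :: "3 \<Rightarrow> 'a::comm_ring_1 poly3 \<Rightarrow> 'a poly3" where
  "partial3 i F =
     (\<Sum>m\<in>Poly_Mapping.keys F.
        Poly_Mapping.single (m - Poly_Mapping.single i 1)
          (of_nat (Poly_Mapping.lookup m i) * Poly_Mapping.lookup F m))"


section \<open>Plane curves\<close>

text \<open>
  A projective plane curve is given by its defining form \<open>F\<close>.  Points of the
  projective plane are represented by non-zero vectors of homogeneous coordinates.
\<close>

definition plane_curve :: "nat \<Rightarrow> 'a::field poly3 \<Rightarrow> bool" where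
  "plane_curve d F \<longleftrightarrow> F \<noteq> 0 \<and> homogeneous3 d F"

definition nonsingular_curve :: "'a::field poly3 \<Rightarrow> bool" where
  "nonsingular_curve F \<longleftrightarrow>
     \<not> (\<exists>x. x \<noteq> 0 \<and> eval3 F x = 0 \<and> (\<forall>i. eval3 (partial3 i F) x = 0))"

text \<open>Two forms define the same curve iff they are proportional, hence the factor \<open>c\<close>.\<close>

definition proj_equivalent :: "'a::field poly3 \<Rightarrow> 'a poly3 \<Rightarrow> bool" where
  "proj_equivalent F G \<longleftrightarrow>
     (\<exists>A c. invertible A \<and> c \<noteq> 0 \<and> linear_subst A F = Const3 c * G)"


section \<open>The automorphism group of a plane curve\<close>

definition GL3 :: "('a::field^3^3) monoid" where
  "GL3 = \<lparr>carrier = {A. invertible A}, mult = (**), one = mat 1\<rparr>"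

definition scalars3 :: "('a::field^3^3) set" where
  "scalars3 = {mat c | c. c \<noteq> 0}"

definition PGL3 :: "('a::field^3^3) set monoid" where
  "PGL3 = GL3 Mod scalars3"

text \<open>
  A projectivity preserves the defining equation iff it multiplies the form by a
  non-zero scalar.  For homogeneous \<open>F\<close> this does not depend on the representative
  in \<open>GL3\<close>.
\<close>

definition preserves_form :: "'a::field poly3 \<Rightarrow> 'a^3^3 \<Rightarrow> bool" where
  "preserves_form F A \<longleftrightarrow> (\<exists>c. c \<noteq> 0 \<and> linear_subst A F = Const3 c * F)"

definition curve_Aut :: "'a::field poly3 \<Rightarrow> ('a^3^3) set monoid" where
  "curve_Aut F = PGL3
     \<lparr>carrier := {scalars3 #>\<^bsub>GL3\<^esub> A | A. A \<in> carrier GL3 \<and> preserves_form F A}\<rparr>"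

lemma group_GL3: "group (GL3 :: ('a::field^3^3) monoid)"
proof (rule groupI)
  fix A :: "'a^3^3" assume "A \<in> carrier GL3"
  then show "\<exists>B\<in>carrier GL3. B \<otimes>\<^bsub>GL3\<^esub> A = \<one>\<^bsub>GL3\<^esub>"
    by (auto simp: GL3_def invertible_def)
next
  have "mat 1 ** mat 1 = (mat 1 :: 'a^3^3)" by simp
  then show "\<one>\<^bsub>GL3\<^esub> \<in> carrier (GL3 :: ('a^3^3) monoid)"
    unfolding GL3_def invertible_def by auto
qed (auto simp: GL3_def invertible_mult matrix_mul_assoc)

lemma insert3_eq_sum:
  assumes "finite S" "Poly_Mapping.keys F \<subseteq> S" "h 0 = 0"
  shows "insert3 h v F = (\<Sum>m\<in>S. h (Poly_Mapping.lookup F m) *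
           (\<Prod>i\<in>UNIV. v i ^ Poly_Mapping.lookup m i))"
  unfolding insert3_def using assms
  by (intro sum.mono_neutral_left) (auto simp: in_keys_iff)

locale coeff_hom =
  fixes h :: "'a::comm_ring_1 \<Rightarrow> 'b::comm_ring_1"
  assumes h_0: "h 0 = 0" and h_1: "h 1 = 1"
    and h_add: "h (a + b) = h a + h b" and h_mult: "h (a * b) = h a * h b"
begin

lemma insert3_single:
  "insert3 h v (Poly_Mapping.single m c) = h c * (\<Prod>i\<in>UNIV. v i ^ Poly_Mapping.lookup m i)"
  by (subst insert3_eq_sum[of "{m}"]) (auto simp: h_0)

lemma insert3_0: "insert3 h v 0 = 0"
  by (simp add: insert3_def)

lemma insert3_add: "insert3 h v (F + G) = insert3 h v F + insert3 h v G"
proof -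
  let ?S = "Poly_Mapping.keys F \<union> Poly_Mapping.keys G"
  have "Poly_Mapping.keys (F + G) \<subseteq> ?S" by (rule Poly_Mapping.keys_add)
  then show ?thesis
    by (simp add: insert3_eq_sum[of ?S] h_0 lookup_add h_add distrib_right sum.distrib)
qed

lemma insert3_sum: "insert3 h v (\<Sum>x\<in>S. f x) = (\<Sum>x\<in>S. insert3 h v (f x))"
  by (induction S rule: infinite_finite_induct) (auto simp: insert3_0 insert3_add)

lemma poly3_as_sum:
  "F = (\<Sum>m\<in>Poly_Mapping.keys F. Poly_Mapping.single m (Poly_Mapping.lookup F m))"
  by (rule poly_mapping_eqI)
    (auto simp: lookup_sum lookup_single when_def in_keys_iff)

lemma insert3_mult: "insert3 h v (F * G) = insert3 h v F * insert3 h v G"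
proof -
  have "F * G = (\<Sum>m\<in>Poly_Mapping.keys F. Poly_Mapping.single m (Poly_Mapping.lookup F m))
       * (\<Sum>n\<in>Poly_Mapping.keys G. Poly_Mapping.single n (Poly_Mapping.lookup G n))"
    by (simp flip: poly3_as_sum)
  also have "insert3 h v \<dots> = insert3 h v F * insert3 h v G"
    unfolding sum_product insert3_sum mult_single insert3_single h_mult lookup_add power_add
      prod.distrib
    by (simp add: insert3_def sum_product mult_ac)
  finally show ?thesis .
qed

lemma insert3_1: "insert3 h v 1 = 1"
  using insert3_single[of v 0 1] by (simp add: h_1)

lemma insert3_power: "insert3 h v (F ^ n) = insert3 h v F ^ n"
  by (induction n) (auto simp: insert3_1 insert3_mult)

lemma insert3_prod: "insert3 h v (\<Prod>x\<in>S. f x) = (\<Prod>x\<in>S. insert3 h v (f x))"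
  by (induction S rule: infinite_finite_induct) (auto simp: insert3_1 insert3_mult)

lemma insert3_Const3: "insert3 h v (Const3 c) = h c"
  by (simp add: Const3_def insert3_single)

lemma insert3_Var3: "insert3 h v (Var3 i) = v i"
proof -
  have "(\<Prod>j\<in>UNIV. v j ^ Poly_Mapping.lookup (Poly_Mapping.single i 1) j)
      = (\<Prod>j\<in>UNIV. if i = j then v j else 1)"
    by (intro prod.cong) (auto simp: lookup_single when_def)
  then show ?thesis by (simp add: Var3_def insert3_single h_1)
qed

end

lemma Const3_hom: "coeff_hom (Const3 :: 'a::comm_ring_1 \<Rightarrow> 'a poly3)"
  by unfold_locales (auto simp: Const3_def single_add mult_single)

lemma id_hom: "coeff_hom (\<lambda>c::'a::comm_ring_1. c)"
  by unfold_locales auto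

interpretation Const3: coeff_hom "Const3 :: 'a::comm_ring_1 \<Rightarrow> 'a poly3"
  by (rule Const3_hom)

interpretation id3: coeff_hom "\<lambda>c::'a::comm_ring_1. c"
  by (rule id_hom)

lemma Const3_sum: "Const3 (\<Sum>x\<in>S. f x) = (\<Sum>x\<in>S. Const3 (f x))"
  by (induction S rule: infinite_finite_induct) (auto simp: Const3.h_0 Const3.h_add)

lemma eval3_linear_subst: "eval3 (linear_subst A F) x = eval3 F (A *v x)"
proof -
  have "insert3 (\<lambda>c. c) (\<lambda>i. x $ i) (linear_subst A F)
     = (\<Sum>m\<in>Poly_Mapping.keys F. Poly_Mapping.lookup F m *
          (\<Prod>i\<in>UNIV. (\<Sum>j\<in>UNIV. A $ i $ j * x $ j) ^ Poly_Mapping.lookup m i))"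
    unfolding linear_subst_def insert3_def[of Const3] id3.insert3_sum id3.insert3_mult
      id3.insert3_prod id3.insert3_power id3.insert3_Const3 id3.insert3_Var3 ..
  then show ?thesis
    by (simp add: eval3_def insert3_def[of _ _ F] matrix_vector_mult_def)
qed

lemma linear_subst_mult: "linear_subst A (linear_subst B F) = linear_subst (B ** A) F"
proof -
  let ?v = "\<lambda>i. \<Sum>j\<in>UNIV. Const3 (A $ i $ j) * Var3 j"
  have "(\<Sum>k\<in>UNIV. Const3 (B $ i $ k) * ?v k) = (\<Sum>j\<in>UNIV. Const3 ((B ** A) $ i $ j) * Var3 j)"
    for i
    unfolding matrix_matrix_mult_def sum_distrib_left vec_lambda_beta Const3_sum Const3.h_mult
      sum_distrib_right
    by (subst sum.swap) (simp add: mult_ac)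
  then have "insert3 Const3 ?v (linear_subst B F)
     = (\<Sum>m\<in>Poly_Mapping.keys F. Const3 (Poly_Mapping.lookup F m) *
          (\<Prod>i\<in>UNIV. (\<Sum>j\<in>UNIV. Const3 ((B ** A) $ i $ j) * Var3 j) ^ Poly_Mapping.lookup m i))"
    unfolding linear_subst_def[of B] insert3_def[of Const3 _ F] Const3.insert3_sum
      Const3.insert3_mult Const3.insert3_prod Const3.insert3_power Const3.insert3_Const3
      Const3.insert3_Var3
    by simp
  then show ?thesis
    by (simp add: linear_subst_def[of A] linear_subst_def[of "B ** A"] insert3_def[of _ _ F])
qed

lemma linear_subst_Const3_mult: "linear_subst A (Const3 c * F) = Const3 c * linear_subst A F"
  by (simp add: linear_subst_def Const3.insert3_mult Const3.insert3_Const3)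

lemma monomial_Var3:
  "Const3 c * (\<Prod>i\<in>UNIV. Var3 i ^ Poly_Mapping.lookup m i) = Poly_Mapping.single m c"
proof -
  have pow: "Var3 i ^ n = (Poly_Mapping.single (Poly_Mapping.single i n) 1 :: 'a::comm_ring_1 poly3)"
    for i n
    by (induction n) (auto simp: Var3_def mult_single simp flip: single_add)
  have "(\<Prod>i\<in>S. Var3 i ^ Poly_Mapping.lookup m i)
      = (Poly_Mapping.single (\<Sum>i\<in>S. Poly_Mapping.single i (Poly_Mapping.lookup m i)) 1 :: 'a poly3)"
    for S
    by (induction S rule: infinite_finite_induct) (auto simp: pow mult_single)
  moreover have "(\<Sum>i\<in>UNIV. Poly_Mapping.single i (Poly_Mapping.lookup m i)) = m"
    by (rule poly_mapping_eqI) (simp add: lookup_sum lookup_single when_def)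
  ultimately show ?thesis by (simp add: Const3_def mult_single)
qed

lemma linear_subst_one: "linear_subst (mat 1) F = F"
proof -
  have "(\<Sum>j\<in>UNIV. Const3 ((mat 1 :: 'a^3^3) $ i $ j) * Var3 j) = Var3 i" for i
  proof -
    have "(\<Sum>j\<in>UNIV. Const3 ((mat 1 :: 'a^3^3) $ i $ j) * Var3 j)
        = (\<Sum>j\<in>UNIV. if i = j then Var3 j else 0)"
      by (intro sum.cong) (auto simp: mat_def Const3.h_0 Const3.h_1)
    then show ?thesis by simp
  qed
  then show ?thesis
    by (simp add: linear_subst_def insert3_def monomial_Var3 flip: Const3.poly3_as_sum)
qed

lemma subgroup_preserves_form:
  "subgroup {A \<in> carrier GL3. preserves_form F A} (GL3 :: ('a::field^3^3) monoid)"
proof (rule group.subgroupI[OF group_GL3])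
  show "{A \<in> carrier GL3. preserves_form F A} \<noteq> {}"
    using Const3.h_1[where 'a='a]
    by (auto simp: GL3_def preserves_form_def linear_subst_one invertible_def
        intro!: exI[of _ "mat 1 :: 'a^3^3"] exI[of _ "1::'a"])
next
  fix A :: "'a^3^3" assume "A \<in> {A \<in> carrier GL3. preserves_form F A}"
  then have A: "A \<in> carrier GL3" and "preserves_form F A" by auto
  then obtain c where c: "c \<noteq> 0" "linear_subst A F = Const3 c * F"
    by (auto simp: preserves_form_def)
  let ?B = "inv\<^bsub>GL3\<^esub> A"
  have B: "?B \<in> carrier GL3" using A group.inv_closed[OF group_GL3] by blast
  have "A ** ?B = mat 1" using group.r_inv[OF group_GL3 A] by (simp add: GL3_def)
  then have "F = linear_subst ?B (linear_subst A F)"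
    by (simp add: linear_subst_mult linear_subst_one)
  also have "\<dots> = Const3 c * linear_subst ?B F"
    by (simp add: c linear_subst_Const3_mult)
  finally have "Const3 (inverse c) * F = Const3 (inverse c) * (Const3 c * linear_subst ?B F)"
    by simp
  also have "\<dots> = linear_subst ?B F"
    using c(1) by (simp add: Const3.h_1 flip: mult.assoc Const3.h_mult)
  finally show "?B \<in> {A \<in> carrier GL3. preserves_form F A}"
    using B c(1) by (auto simp: preserves_form_def intro!: exI[of _ "inverse c"])
next
  fix A B :: "'a^3^3"
  assume *: "A \<in> {A \<in> carrier GL3. preserves_form F A}" "B \<in> {A \<in> carrier GL3. preserves_form F A}"
  then obtain a b where "a \<noteq> 0" "linear_subst A F = Const3 a * F"
    "b \<noteq> 0" "linear_subst B F = Const3 b * F"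
    by (auto simp: preserves_form_def)
  then have "linear_subst (A ** B) F = Const3 (a * b) * F" "a * b \<noteq> 0"
    by (simp_all add: linear_subst_Const3_mult Const3.h_mult mult.assoc flip: linear_subst_mult)
  then have "preserves_form F (A ** B)" unfolding preserves_form_def by blast
  then show "A \<otimes>\<^bsub>GL3\<^esub> B \<in> {A \<in> carrier GL3. preserves_form F A}"
    using * by (auto simp: GL3_def invertible_mult)
qed auto

lemma mat_mult_mat: "mat a ** mat b = (mat (a * b) :: 'a::field^3^3)"
  by (simp add: matrix_matrix_mult_def mat_def vec_eq_iff if_distrib[of "\<lambda>x. x * _"] cong: if_cong)

lemma mat_mult_commute: "mat a ** A = A ** (mat a :: 'a::field^3^3)"
  by (simp add: matrix_matrix_mult_def mat_def vec_eq_iff if_distrib[of "\<lambda>x. x * _"]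
      if_distrib[of "\<lambda>x. _ * x"] mult.commute cong: if_cong)

lemma normal_scalars3: "scalars3 \<lhd> (GL3 :: ('a::field^3^3) monoid)"
proof -
  interpret group "GL3 :: ('a^3^3) monoid" by (rule group_GL3)
  have inv: "inverse c \<noteq> 0 \<and> mat c ** mat (inverse c) = (mat 1 :: 'a^3^3) \<and>
      mat (inverse c) ** mat c = (mat 1 :: 'a^3^3)" if "c \<noteq> 0" for c
    using that by (simp add: mat_mult_mat)
  have car: "mat c \<in> carrier GL3" if "c \<noteq> 0" for c :: 'a
    using inv[OF that] by (auto simp: GL3_def invertible_def)
  have "subgroup (scalars3 :: ('a^3^3) set) GL3"
  proof (rule subgroupI)
    show "(scalars3 :: ('a^3^3) set) \<subseteq> carrier GL3" using car by (auto simp: scalars3_def)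
    show "(scalars3 :: ('a^3^3) set) \<noteq> {}"
      by (auto simp: scalars3_def intro: exI[of _ "1::'a"])
  next
    fix A :: "'a^3^3" assume "A \<in> scalars3"
    then obtain c where c: "c \<noteq> 0" "A = mat c" by (auto simp: scalars3_def)
    then have "inv\<^bsub>GL3\<^esub> A = mat (inverse c)"
      using inv[OF c(1)] car by (intro inv_equality) (auto simp: GL3_def)
    then show "inv\<^bsub>GL3\<^esub> A \<in> scalars3" using inv[OF c(1)] by (auto simp: scalars3_def)
  next
    fix A B :: "'a^3^3" assume "A \<in> scalars3" "B \<in> scalars3"
    then show "A \<otimes>\<^bsub>GL3\<^esub> B \<in> scalars3"
      by (auto simp: scalars3_def GL3_def mat_mult_mat)
  qed
  then show ?thesis
  proof (rule normalI, intro ballI)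
    fix A :: "'a^3^3"
    show "scalars3 #>\<^bsub>GL3\<^esub> A = A <#\<^bsub>GL3\<^esub> scalars3"
      by (auto simp: r_coset_def l_coset_def GL3_def scalars3_def mat_mult_commute)
  qed
qed

lemma group_PGL3: "group (PGL3 :: ('a::field^3^3) set monoid)"
  unfolding PGL3_def by (rule normal.factorgroup_is_group[OF normal_scalars3])

lemma group_curve_Aut: "group (curve_Aut (F :: 'a::field poly3))"
proof -
  interpret h: group_hom GL3 "PGL3 :: ('a^3^3) set monoid" "\<lambda>A. scalars3 #>\<^bsub>GL3\<^esub> A"
    using group_GL3 group_PGL3 normal.r_coset_hom_Mod[OF normal_scalars3]
    by (simp add: group_hom_def group_hom_axioms_def PGL3_def)
  have "subgroup ((\<lambda>A. scalars3 #>\<^bsub>GL3\<^esub> A) ` {A \<in> carrier GL3. preserves_form F A}) PGL3"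
    by (rule h.subgroup_img_is_subgroup[OF subgroup_preserves_form])
  moreover have "(\<lambda>A. scalars3 #>\<^bsub>GL3\<^esub> A) ` {A \<in> carrier GL3. preserves_form F A}
    = {scalars3 #>\<^bsub>GL3\<^esub> A | A. A \<in> carrier GL3 \<and> preserves_form F A}"
    by blast
  ultimately show ?thesis
    unfolding curve_Aut_def using subgroup.subgroup_is_group[OF _ group_PGL3] by simp
qed

end

theory Submission
  imports Defs
begin

text \<open>
  A representative \<open>A\<close> of an automorphism of order \<open>d(d - 1)\<close> has a scalar power, hence is
  diagonal in suitable coordinates, and all monomials of the form then have the same weight.
  Nonsingularity at the three coordinate points puts, for each variable \<open>X\<^sub>i\<close>, some monomial
  \<open>X\<^sub>i\<^sup>d\<^sup>-\<^sup>1X\<^sub>j\<close> into the form.  For every choice of the three indices \<open>j\<close>, except one up to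
  permutation, the weights force the order of \<open>A\<close> to divide a number below \<open>d(d - 1)\<close>.  The exception is
  \<open>X\<^sup>d, Y\<^sup>d, XZ\<^sup>d\<^sup>-\<^sup>1\<close>, where the eigenvalue ratios are primitive roots of unity of the
  coprime orders \<open>d\<close> and \<open>d - 1\<close>, so no further monomial has the same weight.

  For \<open>d \<ge> 5\<close>, let \<open>N(v)\<close> be the set of all \<open>x\<close> where the third polar \<open>T(x; u, v, w)\<close> of
  \<open>X\<^sup>d + Y\<^sup>d + \<alpha>XZ\<^sup>d\<^sup>-\<^sup>1\<close> vanishes for all \<open>u, w\<close>.  Then \<open>N(v)\<close> contains a plane only if \<open>v\<close> is
  a multiple of \<open>e\<^sub>2\<close> (and \<open>N(e\<^sub>2)\<close> is \<open>Y = 0\<close>) or of \<open>e\<^sub>3\<close> (and \<open>N(e\<^sub>3)\<close> is \<open>Z = 0\<close>), and only the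
  second of these points lies on the curve.  Automorphisms preserve all this, so they are diagonal.
\<close>

section \<open>Primitive roots of unity\<close>

text \<open>For positive \<open>n\<close> the equivalence says that the multiplicative order is
  exactly \<open>n\<close>; it turns every equation \<open>z ^ k = 1\<close> into a
  divisibility.\<close>

definition primitive_root_of_unity :: "nat \<Rightarrow> 'a::field \<Rightarrow> bool" where
  "primitive_root_of_unity n z \<longleftrightarrow> (\<forall>k. z ^ k = 1 \<longleftrightarrow> n dvd k)"

lemma primitive_root_of_unityI:
  fixes z :: "'a::field"
  assumes "z ^ n = 1" and "\<And>k. z ^ k = 1 \<Longrightarrow> n dvd k"
  shows "primitive_root_of_unity n z"
  unfolding primitive_root_of_unity_def using assms by (auto simp: power_mult elim!: dvdE)

text \<open>Euclid's algorithm on the exponents.\<close>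

lemma power_gcd_eq_1:
  fixes z :: "'a::field"
  assumes "z ^ m = 1" "z ^ n = 1"
  shows "z ^ gcd m n = 1"
  using assms
proof (induction m n rule: gcd_nat_induct)
  case (step m n)
  have "z ^ m = z ^ (n * (m div n) + m mod n)" by simp
  also have "\<dots> = z ^ (m mod n)"
    using step.prems by (simp only: power_add power_mult) simp
  finally have "z ^ (m mod n) = 1" using step.prems(1) by simp
  then have "z ^ gcd n (m mod n) = 1" using step.IH step.prems(2) by blast
  then show ?case using step.hyps by (simp only: gcd_non_0_nat)
qed simp

text \<open>A root of \<open>1 + X + ... + X^(p - 1)\<close> is a \<open>p\<close>-th root of unity.
  It differs from 1 because the value at 1 is \<open>p\<close>, which is nonzero in characteristic
  zero.\<close>

lemma ex_prime_root_of_unity: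
  assumes "Factorial_Ring.prime p"
  obtains z :: "'a::{alg_closed_field, field_char_0}" where "z \<noteq> 1" "z ^ p = 1"
proof -
  have "p > 1" using assms prime_gt_1_nat by blast
  then obtain z :: 'a where z: "(\<Sum>k\<le>p - 1. 1 * z ^ k) = 0"
    using alg_closed[of "p - 1" "\<lambda>_. 1::'a"] by auto
  have eq: "{..p - 1} = {..<p}" using \<open>p > 1\<close> by auto
  have "z ^ p - 1 = (z - 1) * (\<Sum>k<p. z ^ k)" by (rule power_diff_1_eq)
  moreover have "(\<Sum>k<p. z ^ k) = 0" using z unfolding eq by simp
  ultimately have "z ^ p = 1" by (metis mult_zero_right right_minus_eq)
  moreover have "z \<noteq> 1" using z \<open>p > 1\<close> by auto
  ultimately show ?thesis using that by metis
qed

text \<open>One prime factor \<open>p\<close> is added at a time. If \<open>p\<close> divides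
  \<open>n\<close>, a \<open>p\<close>-th root of a primitive \<open>n\<close>-th root is taken;
  otherwise a primitive \<open>n\<close>-th root is multiplied by a nontrivial \<open>p\<close>-th
  root of unity.\<close>

lemma ex_primitive_root_of_unity:
  assumes "n > 0"
  shows "\<exists>z :: 'a::{alg_closed_field, field_char_0}. primitive_root_of_unity n z"
  using assms
proof (induction n rule: prime_divisors_induct)
  case (unit n)
  then show ?case by (auto simp: primitive_root_of_unity_def intro!: exI[of _ 1])
next
  case (factor p n)
  then have p: "p > 1" and "n > 0" using prime_gt_1_nat by auto
  then obtain z :: 'a where z: "\<And>k. z ^ k = 1 \<longleftrightarrow> n dvd k"
    using factor.IH unfolding primitive_root_of_unity_def by auto
  show ?case
  proof (cases "p dvd n")
    case True
    obtain w where w: "w ^ p = z" using nth_root_exists[of p z] p by auto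
    have "p * n dvd k" if "w ^ k = 1" for k
    proof -
      have "z ^ k = (w ^ k) ^ p" by (simp only: mult.commute[of p k] flip: w power_mult)
      then have "n dvd k" using that by (simp add: z)
      \<comment> \<open>As \<open>p\<close> divides \<open>n\<close>, it divides \<open>k\<close>,
        so \<open>w ^ k\<close> is a power of \<open>z\<close>.\<close>
      then obtain l where l: "k = p * l" using True dvd_trans by blast
      have "z ^ l = 1" using that by (simp add: l power_mult w)
      then show ?thesis by (simp add: z l)
    qed
    moreover have "w ^ (p * n) = 1" by (simp add: power_mult w z)
    ultimately show ?thesis using primitive_root_of_unityI[of _ "p * n"] by metis
  next
    case False
    then have co: "coprime p n" using factor.hyps by (metis Primes.prime_imp_coprime_nat)
    obtain x :: 'a where x: "x \<noteq> 1" "x ^ p = 1" using ex_prime_root_of_unity[OF factor.hyps] .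
    have "p * n dvd k" if "(x * z) ^ k = 1" for k
    proof -
      \<comment> \<open>The \<open>p\<close>-th power removes \<open>x\<close>.\<close>
      have "z ^ (p * k) = ((x * z) ^ k) ^ p"
      proof -
        have "((x * z) ^ k) ^ p = (x ^ p) ^ k * z ^ (p * k)"
          by (simp only: power_mult_distrib mult.commute[of p k] flip: power_mult)
        then show ?thesis by (simp add: x)
      qed
      then have "n dvd p * k" using that by (simp add: z)
      then have n: "n dvd k" using co by (simp add: coprime_commute coprime_dvd_mult_right_iff)
      then have "z ^ k = 1" by (simp add: z)
      then have "x ^ k = 1" using that by (simp add: power_mult_distrib)
      \<comment> \<open>For coprime \<open>p\<close> and \<open>k\<close> this would read
        \<open>x = 1\<close>.\<close>
      then have "x ^ gcd p k = 1" using x by (intro power_gcd_eq_1)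
      then have "\<not> coprime p k" using x by auto
      then have "p dvd k" using factor.hyps by (metis Primes.prime_imp_coprime_nat)
      then show ?thesis using n co by (simp add: divides_mult)
    qed
    moreover have "(x * z) ^ (p * n) = 1"
      using z[of "p * n"] by (simp add: power_mult_distrib power_mult x)
    ultimately show ?thesis using primitive_root_of_unityI[of _ "p * n"] by metis
  qed
qed simp

section \<open>Matrices with a scalar power are diagonalizable\<close>

lemma sum_powers_root_of_unity:
  fixes x :: "'a::field"
  assumes "x ^ n = 1" "x \<noteq> 1"
  shows "(\<Sum>k<n. x ^ k) = 0"
  using power_diff_1_eq[of x n] assms by auto

text \<open>Orthogonality of the characters of a cyclic group: for \<open>0 < j < n\<close> the base
  is an \<open>n\<close>-th root of unity other than 1.\<close>

lemma sum_primitive_root_powers: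
  fixes z :: "'a::field"
  assumes "primitive_root_of_unity n z" "j < n"
  shows "(\<Sum>k<n. (inverse z ^ j) ^ k) = (if j = 0 then of_nat n else 0)"
proof -
  have "(inverse z ^ j) ^ n = 1"
    using assms(1) by (simp add: primitive_root_of_unity_def power_inverse flip: power_mult)
  moreover have "inverse z ^ j \<noteq> 1" if "j \<noteq> 0"
    using assms that by (auto simp: primitive_root_of_unity_def power_inverse dest: nat_dvd_not_less)
  ultimately show ?thesis by (auto intro: sum_powers_root_of_unity)
qed

lemma matrix_vector_mult_sum: "(A :: 'a::field^'n^'m) *v (\<Sum>x\<in>S. f x) = (\<Sum>x\<in>S. A *v f x)"
  by (induction S rule: infinite_finite_induct) (auto simp: matrix_vector_right_distrib)

text \<open>Up to the factor \<open>m\<close>, the matrix shifts the summands by one place, and the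
  summand with index \<open>n\<close> equals that with index 0.\<close>

lemma twisted_orbit_sum_eigenvector:
  fixes A :: "'a::field^'n^'n"
  assumes "((*v) A ^^ n) v = m ^ n *s v" "m \<noteq> 0"
  defines "w \<equiv> \<Sum>j<n. inverse m ^ j *s ((*v) A ^^ j) v"
  shows "A *v w = m *s w"
proof -
  let ?g = "\<lambda>j. inverse m ^ j *s ((*v) A ^^ j) v"
  have "A *v w = (\<Sum>j<n. m *s ?g (Suc j))"
    using assms(2)
    by (simp add: w_def matrix_vector_mult_sum vector_scalar_commute flip: mult.assoc)
  also have "\<dots> = m *s (\<Sum>j<n. ?g (Suc j))"
    by (simp add: vec.scale_sum_right)
  also have "(\<Sum>j<n. ?g (Suc j)) = w"
  proof -
    have "?g n = ?g 0" using assms(2) by (simp add: assms(1) flip: power_mult_distrib)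
    moreover have "?g 0 + (\<Sum>j<n. ?g (Suc j)) = w + ?g n"
      unfolding w_def by (rule trans[OF sum.lessThan_Suc_shift[symmetric] sum.lessThan_Suc])
    ultimately show ?thesis by (simp only: add.commute[of w] add_left_cancel)
  qed
  finally show ?thesis .
qed

text \<open>A discrete Fourier decomposition: every \<open>v\<close> is the average of
  \<open>n\<close> vectors \<open>w k\<close>, each zero or an eigenvector whose eigenvalue is an
  \<open>n\<close>-th root of \<open>c\<close>. So the eigenvectors span. The average divides by
  \<open>n\<close>, hence characteristic zero.\<close>

lemma ex_eigenbasis:
  fixes A :: "'k::{alg_closed_field, field_char_0}^'n^'n"
  assumes "n > 0" "c \<noteq> 0" "\<And>v. ((*v) A ^^ n) v = c *s v"
  obtains P :: "'k^'n^'n" and a where "invertible P" "\<forall>i. A *v column i P = a i *s column i P"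
proof -
  obtain r where r: "r ^ n = c" using nth_root_exists[OF \<open>n > 0\<close>] by blast
  obtain z :: 'k where z: "primitive_root_of_unity n z"
    using ex_primitive_root_of_unity[OF \<open>n > 0\<close>] by blast
  then have z1: "z ^ n = 1" by (simp add: primitive_root_of_unity_def)
  have nz: "r \<noteq> 0" "z \<noteq> 0" using r z1 assms(1,2) by (auto simp: zero_power)
  define E where "E = {v. \<exists>m. A *v v = m *s v}"
  have "v \<in> vec.span E" for v
  proof -
    \<comment> \<open>\<open>w k\<close> is \<open>n\<close> times the component of \<open>v\<close>
      for the eigenvalue \<open>z ^ k * r\<close>; for \<open>k < n\<close> these values run through
      all \<open>n\<close>-th roots of \<open>c\<close>.\<close>
    define w where "w k = (\<Sum>j<n. inverse (z ^ k * r) ^ j *s ((*v) A ^^ j) v)" for k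
    have "w k \<in> E" for k
    proof -
      have "(z ^ k * r) ^ n = c"
      proof -
        have "(z ^ k * r) ^ n = (z ^ n) ^ k * r ^ n"
          by (simp only: power_mult_distrib mult.commute[of k n] flip: power_mult)
        then show ?thesis by (simp add: z1 r)
      qed
      then have "A *v w k = (z ^ k * r) *s w k"
        unfolding w_def using assms(3) nz by (intro twisted_orbit_sum_eigenvector) auto
      then show ?thesis by (auto simp: E_def)
    qed
    then have "(\<Sum>k<n. w k) \<in> vec.span E" by (intro vec.span_sum vec.span_base)
    moreover have "(\<Sum>k<n. w k) = of_nat n *s v"
    proof -
      \<comment> \<open>After the two sums are exchanged, orthogonality leaves only
        \<open>j = 0\<close>.\<close>
      have "(\<Sum>k<n. w k)
          = (\<Sum>j<n. (inverse r ^ j * (\<Sum>k<n. (inverse z ^ j) ^ k)) *s ((*v) A ^^ j) v)"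
      proof -
        have "inverse (z ^ k * r) ^ j = inverse r ^ j * (inverse z ^ j) ^ k" for k j
          by (simp only: inverse_mult_distrib power_mult_distrib mult.commute[of k j]
              mult.commute[of "inverse r ^ j"] flip: power_mult power_inverse)
        then show ?thesis
          unfolding w_def vec.scale_sum_left sum_distrib_left by (subst sum.swap) simp
      qed
      also have "\<dots> = (\<Sum>j<n. if j = 0 then of_nat n *s v else 0)"
        by (intro sum.cong) (auto simp: sum_primitive_root_powers[OF z])
      also have "\<dots> = of_nat n *s v" using assms(1) by (simp add: sum.delta)
      finally show ?thesis .
    qed
    then have "v = inverse (of_nat n) *s (\<Sum>k<n. w k)"
      using assms(1) by (simp add: vec.scale_scale)
    ultimately show ?thesis by (metis vec.span_scale)
  qed
  then have E: "vec.span E = UNIV" by blast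
  \<comment> \<open>A basis is chosen among the eigenvectors; its members become the columns of
    \<open>P\<close>.\<close>
  obtain B where B: "B \<subseteq> E" "vec.independent B" "E \<subseteq> vec.span B"
    using vec.maximal_independent_subset by blast
  then have span: "vec.span B = UNIV"
    using E by (metis vec.span_minimal vec.subspace_span top.extremum_uniqueI)
  then have "card B = CARD('n)"
    using vec.dim_eq_card_independent[OF B(2)] vec.dim_span[of B] by (simp add: vec.dim_UNIV card_cart_basis)
  moreover have "finite B" using B(2) by (rule vec.finiteI_independent)
  ultimately obtain f where f: "bij_betw f (UNIV :: 'n set) B"
    using finite_same_card_bij[of "UNIV :: 'n set" B] by auto
  define P where "P = (\<chi> i j. f j $ i)"
  have col: "column j P = f j" for j by (simp add: P_def column_def vec_eq_iff)
  then have "columns P = B" using f by (auto simp: columns_def bij_betw_def)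
  then have "invertible P"
    using span by (metis invertible_right_inverse matrix_right_invertible_span_columns)
  moreover have "\<forall>j. \<exists>m. A *v column j P = m *s column j P"
    using B(1) f by (auto simp: col E_def bij_betw_def)
  then have "\<exists>a. \<forall>j. A *v column j P = a j *s column j P" by (rule choice)
  ultimately show ?thesis using that by blast
qed

section \<open>Singular points and linear substitutions\<close>

interpretation pCons_hom: coeff_hom "\<lambda>c::'a::comm_ring_1. [:c:]"
  by unfold_locales (auto simp: one_pCons)

text \<open>The restriction of \<open>F\<close> to the line \<open>x + t v\<close>, as a polynomial
  in \<open>t\<close>. Derivatives along lines transform under a linear map by mere evaluation,
  which replaces a chain rule for \<open>partial3\<close>.\<close>

definition line_poly :: "'a::comm_ring_1 poly3 \<Rightarrow> 'a^3 \<Rightarrow> 'a^3 \<Rightarrow> 'a poly" where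
  "line_poly F x v = insert3 (\<lambda>c. [:c:]) (\<lambda>i. [:x $ i, v $ i:]) F"

lemma poly_line_poly: "poly (line_poly F x v) t = eval3 F (x + t *s v)"
  by (simp add: line_poly_def eval3_def insert3_def poly_sum poly_prod)

lemma eval3_partial3:
  "eval3 (partial3 i F) x = (\<Sum>m\<in>Poly_Mapping.keys F.
     of_nat (Poly_Mapping.lookup m i) * Poly_Mapping.lookup F m *
       (\<Prod>j\<in>UNIV. x $ j ^ Poly_Mapping.lookup (m - Poly_Mapping.single i 1) j))"
  unfolding eval3_def partial3_def id3.insert3_sum id3.insert3_single by simp

text \<open>The product rule, monomial by monomial. Where \<open>m\<close> lacks the variable
  \<open>i\<close>, the truncated exponent is harmless since the factor \<open>of_nat 0\<close>
  kills the term.\<close>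

lemma pderiv_line_poly:
  fixes F :: "'a::idom poly3"
  shows "poly (pderiv (line_poly F x v)) 0 = (\<Sum>i\<in>UNIV. v $ i * eval3 (partial3 i F) x)"
proof -
  have *: "poly (pderiv (\<Prod>j\<in>UNIV. [:x $ j, v $ j:] ^ Poly_Mapping.lookup m j)) 0
      = (\<Sum>i\<in>UNIV. v $ i * (of_nat (Poly_Mapping.lookup m i) *
          (\<Prod>j\<in>UNIV. x $ j ^ Poly_Mapping.lookup (m - Poly_Mapping.single i 1) j)))" for m
  proof -
    have "poly ((\<Prod>j\<in>UNIV - {i}. [:x $ j, v $ j:] ^ Poly_Mapping.lookup m j) *
              pderiv ([:x $ i, v $ i:] ^ Poly_Mapping.lookup m i)) 0
        = v $ i * (of_nat (Poly_Mapping.lookup m i) *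
          (\<Prod>j\<in>UNIV. x $ j ^ Poly_Mapping.lookup (m - Poly_Mapping.single i 1) j))" for i
    proof -
      have "(\<Prod>j\<in>UNIV. x $ j ^ Poly_Mapping.lookup (m - Poly_Mapping.single i 1) j)
          = x $ i ^ (Poly_Mapping.lookup m i - 1) * (\<Prod>j\<in>UNIV - {i}. x $ j ^ Poly_Mapping.lookup m j)"
        by (subst prod.remove[of _ i])
          (auto simp: lookup_minus lookup_single when_def intro!: prod.cong)
      then show ?thesis
        by (simp add: poly_prod pderiv_power pderiv_pCons)
    qed
    then show ?thesis unfolding pderiv_prod poly_sum by simp
  qed
  have "poly (pderiv (line_poly F x v)) 0 = (\<Sum>m\<in>Poly_Mapping.keys F.
      Poly_Mapping.lookup F m * poly (pderiv (\<Prod>j\<in>UNIV. [:x $ j, v $ j:] ^ Poly_Mapping.lookup m j)) 0)"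
    unfolding line_poly_def insert3_def
    by (simp add: poly_sum higher_pderiv_sum[of 1, simplified] pderiv_smult)
  also have "\<dots> = (\<Sum>i\<in>UNIV. v $ i * eval3 (partial3 i F) x)"
    unfolding * eval3_partial3 sum_distrib_left
    by (subst sum.swap) (simp add: mult_ac)
  finally show ?thesis .
qed

text \<open>Both sides take the same values for all \<open>t\<close>, and a field of characteristic
  zero is infinite.\<close>

lemma line_poly_linear_subst:
  fixes F :: "'a::field_char_0 poly3"
  shows "line_poly (linear_subst A F) x v = line_poly F (A *v x) (A *v v)"
  by (simp add: poly_eq_poly_eq_iff[symmetric] fun_eq_iff poly_line_poly eval3_linear_subst
      matrix_vector_right_distrib vector_scalar_commute)

text \<open>A coordinate-free form of nonsingularity: directional derivatives are linear
  combinations of the partial ones, and the directions \<open>axis i 1\<close> give these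
  back.\<close>

lemma nonsingular_curve_iff_line_poly:
  fixes F :: "'a::field_char_0 poly3"
  shows "nonsingular_curve F \<longleftrightarrow>
    (\<forall>x. x \<noteq> 0 \<longrightarrow> poly (line_poly F x 0) 0 = 0 \<longrightarrow> (\<exists>v. poly (pderiv (line_poly F x v)) 0 \<noteq> 0))"
proof -
  have "(\<forall>v. poly (pderiv (line_poly F x v)) 0 = 0) \<longleftrightarrow> (\<forall>i. eval3 (partial3 i F) x = 0)" for x
  proof (intro iffI allI)
    fix i assume "\<forall>v. poly (pderiv (line_poly F x v)) 0 = 0"
    then have "(\<Sum>j\<in>UNIV. axis i 1 $ j * eval3 (partial3 j F) x) = 0"
      by (simp add: pderiv_line_poly)
    also have "(\<Sum>j\<in>UNIV. axis i 1 $ j * eval3 (partial3 j F) x)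
        = (\<Sum>j\<in>UNIV. if j = i then eval3 (partial3 j F) x else 0)"
      by (intro sum.cong) (auto simp: axis_def)
    finally show "eval3 (partial3 i F) x = 0" by simp
  qed (simp add: pderiv_line_poly)
  then have "(\<exists>v. poly (pderiv (line_poly F x v)) 0 \<noteq> 0) \<longleftrightarrow> (\<exists>i. eval3 (partial3 i F) x \<noteq> 0)" for x
    by blast
  then show ?thesis unfolding nonsingular_curve_def by (auto simp: poly_line_poly)
qed

text \<open>Points are carried over by \<open>A\<close>, directions are pulled back by its inverse
  \<open>B\<close>.\<close>

lemma nonsingular_curve_linear_subst:
  fixes F :: "'a::field_char_0 poly3"
  assumes "nonsingular_curve F" "invertible A"
  shows "nonsingular_curve (linear_subst A F)"
proof -
  obtain B where B: "B ** A = mat 1" "A ** B = mat 1" using assms(2) by (auto simp: invertible_def)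
  then have inv: "B *v (A *v x) = x" "A *v (B *v x) = x" for x
    by (simp_all add: matrix_vector_mul_assoc)
  show ?thesis unfolding nonsingular_curve_iff_line_poly line_poly_linear_subst
  proof (intro allI impI)
    fix x :: "'a^3" assume x: "x \<noteq> 0" "poly (line_poly F (A *v x) (A *v 0)) 0 = 0"
    have "A *v x \<noteq> 0" using x(1) inv(1)[of x] by auto
    then obtain v where "poly (pderiv (line_poly F (A *v x) v)) 0 \<noteq> 0"
      using assms(1) x(2) unfolding nonsingular_curve_iff_line_poly by auto
    then show "\<exists>v. poly (pderiv (line_poly F (A *v x) (A *v v))) 0 \<noteq> 0"
      by (intro exI[of _ "B *v v"]) (simp add: inv)
  qed
qed

text \<open>At the coordinate point \<open>axis i 1\<close> every monomial containing another
  variable vanishes. So the form and its partial derivatives see there only the coefficients of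
  \<open>X_i^(d - 1) X_j\<close>, with \<open>j = i\<close> allowed. If all of these were zero, the
  point would be singular.\<close>

lemma nonsingular_curve_lookup:
  fixes F :: "'a::field poly3"
  assumes "homogeneous3 d F" "nonsingular_curve F" "d > 0"
  obtains j where "Poly_Mapping.lookup F (Poly_Mapping.single i (d - 1) + Poly_Mapping.single j 1) \<noteq> 0"
proof -
  have ax: "(\<Prod>l\<in>UNIV. (axis i 1 :: 'a^3) $ l ^ Poly_Mapping.lookup m l) = 0"
    if m: "m \<noteq> Poly_Mapping.single i (Poly_Mapping.lookup m i)" for m
  proof -
    obtain l where "Poly_Mapping.lookup m l
        \<noteq> Poly_Mapping.lookup (Poly_Mapping.single i (Poly_Mapping.lookup m i)) l"
      using m by (metis poly_mapping_eqI)
    then have "l \<noteq> i" "Poly_Mapping.lookup m l \<noteq> 0"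
      by (auto simp: lookup_single when_def split: if_splits)
    then have "(axis i 1 :: 'a^3) $ l ^ Poly_Mapping.lookup m l = 0" by (simp add: axis_def)
    then show ?thesis by (metis UNIV_I finite prod_zero)
  qed
  show ?thesis
  proof (rule ccontr)
    assume "\<not> thesis"
    with that have no: "Poly_Mapping.lookup F (Poly_Mapping.single i (d - 1) + Poly_Mapping.single j 1) = 0"
      for j by blast
    have deg: "(\<Sum>l\<in>UNIV. Poly_Mapping.lookup m l) = d" if "m \<in> Poly_Mapping.keys F" for m
      using assms(1) that by (auto simp: homogeneous3_def)
    have "eval3 F (axis i 1) = 0"
      unfolding eval3_def insert3_def
    proof (intro sum.neutral ballI)
      fix m assume m: "m \<in> Poly_Mapping.keys F"
      have "m \<noteq> Poly_Mapping.single i (Poly_Mapping.lookup m i)"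
      proof
        assume "m = Poly_Mapping.single i (Poly_Mapping.lookup m i)"
        then obtain k where k: "m = Poly_Mapping.single i k" by blast
        then have "k = d" using deg[OF m] by (simp add: lookup_single when_def)
        then have "m = Poly_Mapping.single i (d - 1) + Poly_Mapping.single i 1"
          using assms(3) k by (simp flip: single_add)
        then show False using no m by (simp add: in_keys_iff)
      qed
      then show "Poly_Mapping.lookup F m * (\<Prod>l\<in>UNIV. (axis i 1 :: 'a^3) $ l ^ Poly_Mapping.lookup m l) = 0"
        by (simp add: ax)
    qed
    moreover have "eval3 (partial3 j F) (axis i 1) = 0" for j
      unfolding eval3_partial3
    proof (intro sum.neutral ballI)
      fix m assume m: "m \<in> Poly_Mapping.keys F"
      let ?m = "m - Poly_Mapping.single j 1"
      show "of_nat (Poly_Mapping.lookup m j) * Poly_Mapping.lookup F m *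
          (\<Prod>l\<in>UNIV. (axis i 1 :: 'a^3) $ l ^ Poly_Mapping.lookup ?m l) = 0"
      proof (cases "Poly_Mapping.lookup m j = 0")
        case False
        then have mj: "m = ?m + Poly_Mapping.single j 1"
          by (intro poly_mapping_eqI) (auto simp: lookup_add lookup_minus lookup_single when_def)
        have "?m \<noteq> Poly_Mapping.single i (Poly_Mapping.lookup ?m i)"
        proof
          assume "?m = Poly_Mapping.single i (Poly_Mapping.lookup ?m i)"
          then obtain k where k: "?m = Poly_Mapping.single i k" by blast
          then have mk: "m = Poly_Mapping.single i k + Poly_Mapping.single j 1" using mj by simp
          then have "k + 1 = d"
            using deg[OF m] by (simp add: lookup_add lookup_single when_def sum.distrib)
          then show False using no[of j] m mk by (auto simp: in_keys_iff)
        qed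
        then show ?thesis by (simp add: ax)
      qed simp
    qed
    moreover have "axis i 1 \<noteq> (0 :: 'a^3)" by (simp add: axis_eq_0_iff)
    ultimately show False using assms(2) unfolding nonsingular_curve_def by blast
  qed
qed

section \<open>Third polars and diagonal automorphisms\<close>

text \<open>One step of polarisation: equivariance up to the factor \<open>c\<close> passes to
  directional derivatives. \<open>f\<close> and \<open>g\<close> are kept apart because from the
  second step on they carry the earlier directions, transformed by \<open>A\<close> in
  \<open>f\<close> but not in \<open>g\<close>.\<close>

lemma polar_equivariant:
  fixes A :: "'a::field_char_0^'n^'n"
  assumes "\<And>x v t. poly (P x v) t = f (x + t *s v)" "\<And>x v t. poly (Q x v) t = g (x + t *s v)"
    and "\<And>x. f (A *v x) = c * g x"
  shows "poly (pderiv (P (A *v x) (A *v v))) 0 = c * poly (pderiv (Q x v)) 0"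
proof -
  have "poly (P (A *v x) (A *v v)) t = poly (Polynomial.smult c (Q x v)) t" for t
    using assms(3)[of "x + t *s v"]
    by (simp add: assms(1,2) matrix_vector_right_distrib vector_scalar_commute)
  then have "P (A *v x) (A *v v) = Polynomial.smult c (Q x v)"
    by (simp add: poly_eq_poly_eq_iff[symmetric] fun_eq_iff)
  then show ?thesis by (simp add: pderiv_smult)
qed

section \<open>The normal form and its polars\<close>

definition homology_form :: "nat \<Rightarrow> 'a::comm_ring_1 \<Rightarrow> 'a^3 \<Rightarrow> 'a" where
  "homology_form d \<alpha> x = x $ 1 ^ d + x $ 2 ^ d + \<alpha> * x $ 1 * x $ 3 ^ (d - 1)"

text \<open>The polars of \<open>homology_form d\<close> are indexed by \<open>e = d - 4\<close>, to avoid subtraction in exponents.\<close>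

definition polar1 :: "nat \<Rightarrow> 'a::comm_ring_1 \<Rightarrow> 'a^3 \<Rightarrow> 'a^3 \<Rightarrow> 'a" where
  "polar1 e \<alpha> x u = of_nat (e + 4) * (x $ 1 ^ (e + 3) * u $ 1 + x $ 2 ^ (e + 3) * u $ 2)
     + \<alpha> * (u $ 1 * x $ 3 ^ (e + 3) + of_nat (e + 3) * x $ 1 * x $ 3 ^ (e + 2) * u $ 3)"

definition polar2 :: "nat \<Rightarrow> 'a::comm_ring_1 \<Rightarrow> 'a^3 \<Rightarrow> 'a^3 \<Rightarrow> 'a^3 \<Rightarrow> 'a" where
  "polar2 e \<alpha> x u v = of_nat ((e + 4) * (e + 3)) *
       (x $ 1 ^ (e + 2) * u $ 1 * v $ 1 + x $ 2 ^ (e + 2) * u $ 2 * v $ 2)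
     + \<alpha> * of_nat (e + 3) * ((u $ 1 * v $ 3 + u $ 3 * v $ 1) * x $ 3 ^ (e + 2)
       + of_nat (e + 2) * x $ 1 * x $ 3 ^ (e + 1) * u $ 3 * v $ 3)"

definition polar3 :: "nat \<Rightarrow> 'a::comm_ring_1 \<Rightarrow> 'a^3 \<Rightarrow> 'a^3 \<Rightarrow> 'a^3 \<Rightarrow> 'a^3 \<Rightarrow> 'a" where
  "polar3 e \<alpha> x u v w = of_nat ((e + 4) * (e + 3) * (e + 2)) *
       (x $ 1 ^ (e + 1) * u $ 1 * v $ 1 * w $ 1 + x $ 2 ^ (e + 1) * u $ 2 * v $ 2 * w $ 2)
     + \<alpha> * of_nat ((e + 3) * (e + 2)) *
       ((u $ 1 * v $ 3 * w $ 3 + u $ 3 * v $ 1 * w $ 3 + u $ 3 * v $ 3 * w $ 1) * x $ 3 ^ (e + 1)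
       + of_nat (e + 1) * x $ 1 * x $ 3 ^ e * u $ 3 * v $ 3 * w $ 3)"

lemma pderiv_linear_power:
  "pderiv ([:a, b:] ^ Suc n) = Polynomial.smult (of_nat (Suc n) * b) ([:a, b:] ^ n)"
  for a b :: "'a::idom"
  by (subst pderiv_power_Suc) (simp add: pderiv_pCons mult.commute)

text \<open>Three applications of \<open>polar_equivariant\<close>, each to the previous polar
  restricted to a line in its base point.\<close>

lemma polar3_equivariant:
  fixes A :: "'a::field_char_0^3^3"
  assumes "\<And>x. homology_form (e + 4) \<alpha> (A *v x) = c * homology_form (e + 4) \<alpha> x"
  shows "polar3 e \<alpha> (A *v x) (A *v u) (A *v v) (A *v w) = c * polar3 e \<alpha> x u v w"
proof -
  let ?L = "\<lambda>i x u. [:x $ i, u $ i:] :: 'a poly"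
  \<comment> \<open>Exponents are written with \<open>Suc\<close> to match
    \<open>pderiv_linear_power\<close>.\<close>
  let ?P0 = "\<lambda>x u. ?L 1 x u ^ Suc (e + 3) + ?L 2 x u ^ Suc (e + 3)
      + Polynomial.smult \<alpha> (?L 1 x u * ?L 3 x u ^ Suc (e + 2))"
  have "poly (?P0 x u) t = homology_form (e + 4) \<alpha> (x + t *s u)" for x u t
    by (simp add: homology_form_def eval_nat_numeral algebra_simps)
  note p = polar_equivariant[of ?P0, OF this this assms]
  have "poly (pderiv (?P0 x u)) 0 = polar1 e \<alpha> x u" for x u
    unfolding pderiv_add pderiv_smult pderiv_mult pderiv_linear_power polar1_def
    by (simp add: pderiv_pCons eval_nat_numeral algebra_simps)
  note p1 = p[unfolded this]
  let ?P1 = "\<lambda>u x v. Polynomial.smult (of_nat (e + 4)) (Polynomial.smult (u $ 1) (?L 1 x v ^ Suc (e + 2))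
        + Polynomial.smult (u $ 2) (?L 2 x v ^ Suc (e + 2)))
      + Polynomial.smult \<alpha> (Polynomial.smult (u $ 1) (?L 3 x v ^ Suc (e + 2))
        + Polynomial.smult (of_nat (e + 3) * u $ 3) (?L 1 x v * ?L 3 x v ^ Suc (e + 1)))"
  have "poly (?P1 u x v) t = polar1 e \<alpha> (x + t *s v) u" for x u v t
    by (simp add: polar1_def eval_nat_numeral algebra_simps)
  note p = polar_equivariant[where P = "?P1 (A *v u)" and Q = "?P1 u" for u, OF this this p1]
  have "poly (pderiv (?P1 u x v)) 0 = polar2 e \<alpha> x u v" for x u v
    unfolding pderiv_add pderiv_smult pderiv_mult pderiv_linear_power polar2_def
    by (simp add: pderiv_pCons eval_nat_numeral algebra_simps)
  note p2 = p[unfolded this]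
  let ?P2 = "\<lambda>u v x w. Polynomial.smult (of_nat ((e + 4) * (e + 3))) (Polynomial.smult (u $ 1 * v $ 1) (?L 1 x w ^ Suc (e + 1))
        + Polynomial.smult (u $ 2 * v $ 2) (?L 2 x w ^ Suc (e + 1)))
      + Polynomial.smult (\<alpha> * of_nat (e + 3)) (Polynomial.smult (u $ 1 * v $ 3 + u $ 3 * v $ 1) (?L 3 x w ^ Suc (e + 1))
        + Polynomial.smult (of_nat (e + 2) * u $ 3 * v $ 3) (?L 1 x w * ?L 3 x w ^ Suc e))"
  have "poly (?P2 u v x w) t = polar2 e \<alpha> (x + t *s w) u v" for x u v w t
    by (simp add: polar2_def eval_nat_numeral algebra_simps)
  note p = polar_equivariant[where P = "?P2 (A *v u) (A *v v)" and Q = "?P2 u v" for u v, OF this this p2]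
  have "poly (pderiv (?P2 u v x w)) 0 = polar3 e \<alpha> x u v w" for x u v w
    unfolding pderiv_add pderiv_smult pderiv_mult pderiv_linear_power polar3_def
    by (simp add: pderiv_pCons eval_nat_numeral algebra_simps)
  note p3 = p[unfolded this]
  show ?thesis by (rule p3)
qed

text \<open>This computes the set \<open>N(w)\<close> of the overview: \<open>polar3\<close> is
  bilinear in \<open>u\<close> and \<open>v\<close>, so the conditions are read off at pairs of
  basis vectors.\<close>

lemma polar3_degenerate_iff:
  fixes x w :: "'a::field_char_0^3"
  assumes "e > 0" "\<alpha> \<noteq> 0"
  shows "(\<forall>u v. polar3 e \<alpha> x u v w = 0) \<longleftrightarrow>
    x $ 1 * w $ 1 = 0 \<and> x $ 2 * w $ 2 = 0 \<and> x $ 3 * w $ 3 = 0 \<and> x $ 3 * w $ 1 = 0"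
proof (intro iffI)
  assume "x $ 1 * w $ 1 = 0 \<and> x $ 2 * w $ 2 = 0 \<and> x $ 3 * w $ 3 = 0 \<and> x $ 3 * w $ 1 = 0"
  then show "\<forall>u v. polar3 e \<alpha> x u v w = 0"
    using assms(1) by (auto simp: polar3_def)
next
  assume *: "\<forall>u v. polar3 e \<alpha> x u v w = 0"
  have nz: "of_nat (Suc n) \<noteq> (0::'a)" for n by (rule of_nat_neq_0)
  have 11: "x $ 1 * w $ 1 = 0"
    using *[rule_format, of "axis 1 1" "axis 1 1"] nz[of "e + 3"] nz[of "e + 2"] nz[of "e + 1"]
    by (auto simp: polar3_def axis_def eval_nat_numeral simp del: of_nat_Suc)
  moreover have "x $ 2 * w $ 2 = 0"
    using *[rule_format, of "axis 2 1" "axis 2 1"] nz[of "e + 3"] nz[of "e + 2"] nz[of "e + 1"]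
    by (auto simp: polar3_def axis_def eval_nat_numeral simp del: of_nat_Suc)
  moreover have 33: "x $ 3 * w $ 3 = 0"
    using *[rule_format, of "axis 1 1" "axis 3 1"] nz[of "e + 2"] nz[of "e + 1"] 11 assms(2)
    by (auto simp: polar3_def axis_def eval_nat_numeral simp del: of_nat_Suc)
  \<comment> \<open>Here \<open>d \<ge> 5\<close> enters: the other summand contains
    \<open>x $ 3 ^ e * w $ 3\<close>, which \<open>33\<close> kills only for
    \<open>e > 0\<close>.\<close>
  moreover have "x $ 3 * w $ 1 = 0"
    using *[rule_format, of "axis 3 1" "axis 3 1"] nz[of "e + 2"] nz[of "e + 1"] 33 assms
    by (auto simp: polar3_def axis_def eval_nat_numeral simp del: of_nat_Suc)
  ultimately show "x $ 1 * w $ 1 = 0 \<and> x $ 2 * w $ 2 = 0 \<and> x $ 3 * w $ 3 = 0 \<and> x $ 3 * w $ 1 = 0"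
    by simp
qed

text \<open>Incidences between the coordinate points and their sets \<open>N\<close> must hold for
  the columns of \<open>A\<close> too; this forces products of entries to vanish.\<close>

lemma homology_form_automorphism_diagonal:
  fixes A :: "'a::field_char_0^3^3"
  assumes "d \<ge> 5" "\<alpha> \<noteq> 0" "invertible A"
    and eq: "\<And>x. homology_form d \<alpha> (A *v x) = c * homology_form d \<alpha> x"
    and "i \<noteq> j"
  shows "A $ i $ j = 0"
proof -
  define e where "e = d - 4"
  have e: "e > 0" "d = e + 4" using assms(1) by (auto simp: e_def)
  obtain B where B: "A ** B = mat 1" using assms(3) by (auto simp: invertible_def)
  then have AB: "A *v (B *v u) = u" for u by (simp add: matrix_vector_mul_assoc)
  have col: "(A *v axis j 1) $ i = A $ i $ j" for i j
    by (simp add: matrix_vector_mult_def axis_def if_distrib cong: if_cong)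
  \<comment> \<open>For these \<open>i\<close> and \<open>j\<close> the vector
    \<open>axis i 1\<close> lies in \<open>N\<close> of \<open>axis j 1\<close>. Index
    \<open>j = 1\<close> is left out since \<open>axis 3 1\<close> violates the condition
    \<open>x $ 3 * w $ 1 = 0\<close>. \<open>B\<close> writes arbitrary directions as images under
    \<open>A\<close>.\<close>
  have N: "A $ 1 $ i * A $ 1 $ j = 0 \<and> A $ 2 $ i * A $ 2 $ j = 0 \<and>
           A $ 3 $ i * A $ 3 $ j = 0 \<and> A $ 3 $ i * A $ 1 $ j = 0"
    if "i \<noteq> j" "j \<noteq> 1" for i j
  proof -
    have "\<forall>u v. polar3 e \<alpha> (axis i 1) u v (axis j 1) = 0"
      using that unfolding polar3_degenerate_iff[OF e(1) assms(2)] by (auto simp: axis_def)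
    then have "polar3 e \<alpha> (A *v axis i 1) (A *v (B *v u)) (A *v (B *v v)) (A *v axis j 1) = 0" for u v
      using polar3_equivariant[OF eq[unfolded e(2)]] by simp
    then show ?thesis
      using polar3_degenerate_iff[OF e(1) assms(2), of "A *v axis i 1" "A *v axis j 1"]
      by (simp add: AB col)
  qed
  have det: "det A \<noteq> 0" using assms(3) by (simp add: invertible_det_nz)
  have "homology_form d \<alpha> (axis 3 1) = 0"
    using assms(1) by (simp add: homology_form_def axis_def)
  then have G3: "homology_form d \<alpha> (A *v axis 3 1) = 0" by (simp add: eq)
  note N13 = N[of 1 3] and N23 = N[of 2 3] and N12 = N[of 1 2] and N32 = N[of 3 2]
  \<comment> \<open>Otherwise rows 1 and 3 would both be zero outside column 3.\<close>
  have a13: "A $ 1 $ 3 = 0"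
    using N13 N23 det by (auto simp: det_3)
  \<comment> \<open>The image of the curve point \<open>axis 3 1\<close> is on the curve, and by
    \<open>a13\<close> the form takes the value \<open>A $ 2 $ 3 ^ d\<close> there. This rules out
    an image proportional to \<open>axis 2 1\<close>.\<close>
  have a23: "A $ 2 $ 3 = 0"
  proof (rule ccontr)
    assume "A $ 2 $ 3 \<noteq> 0"
    moreover from this have "A $ 3 $ 3 \<noteq> 0"
      using G3 a13 assms(1) by (auto simp: homology_form_def col power_0_left)
    ultimately show False using N13 N23 det by (auto simp: det_3)
  qed
  then have a33: "A $ 3 $ 3 \<noteq> 0" using a13 det by (auto simp: det_3)
  then have a3: "A $ 3 $ 1 = 0" "A $ 3 $ 2 = 0" using N13 N23 by auto
  have a12: "A $ 1 $ 2 = 0" using a33 N32 by auto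
  then have "A $ 2 $ 2 \<noteq> 0" using a3 a23 a13 det by (auto simp: det_3)
  then have "A $ 2 $ 1 = 0" using N12 by auto
  then show ?thesis
    using assms(5) a13 a23 a3 a12 exhaust_3[of i] exhaust_3[of j] by auto
qed

section \<open>Exponents of diagonal automorphisms\<close>

text \<open>
  In the application, \<open>k = d - 1\<close>, \<open>a\<close> lists the eigenvalues, \<open>l\<close> is the common weight of the
  monomials, and \<open>M i j\<close> says that the monomial \<open>X\<^sub>i\<^sup>kX\<^sub>j\<close> occurs in the form.
\<close>

lemma exponent_cases:
  fixes a :: "3 \<Rightarrow> 'a::field" and M :: "3 \<Rightarrow> 3 \<Rightarrow> bool"
  assumes "k \<ge> 3" and nz: "\<And>i. a i \<noteq> 0" and M: "\<And>i. \<exists>j. M i j"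
    and R: "\<And>i j. M i j \<Longrightarrow> a i ^ k * a j = l"
    and ord: "\<And>N. N > 0 \<Longrightarrow> (\<And>i j. a i ^ N = a j ^ N) \<Longrightarrow> k * (k + 1) dvd N"
  obtains i j m where "\<forall>x. x = i \<or> x = j \<or> x = m" "i \<noteq> j" "i \<noteq> m" "j \<noteq> m" "M i i" "M j j" "M m i"
proof -
  define U where "U i j m \<longleftrightarrow> (\<forall>x. x = i \<or> x = j \<or> x = m) \<and> i \<noteq> j \<and> i \<noteq> m \<and> j \<noteq> m" for i j m :: 3
  have perm: "U 1 2 3" "U 1 3 2" "U 2 1 3" "U 2 3 1" "U 3 1 2" "U 3 2 1"
    using exhaust_3 by (simp_all add: U_def) blast+
  define q where "q = k - 1"
  have k: "k = Suc q" using assms(1) by (simp add: q_def)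
  have "q \<ge> 2" using assms(1) by (simp add: q_def)
  \<comment> \<open>The exponents that \<open>L1\<close> to \<open>L6\<close> use, in this
    order.\<close>
  then have bounds: "k + 1 < k * (k + 1)" "k < k * (k + 1)" "k * k < k * (k + 1)"
    "(k + 1) * q < k * (k + 1)" "q * k + 1 < k * (k + 1)" "k * q < k * (k + 1)"
    by (simp_all add: k algebra_simps)
  have pos: "k > 0" "q > 0" using assms(1) by (simp_all add: q_def)
  \<comment> \<open>Each of \<open>L1\<close> to \<open>L6\<close> finds an exponent
    \<open>N\<close> below \<open>k * (k + 1)\<close> for which all \<open>a x ^ N\<close> agree,
    contrary to \<open>ord\<close>.\<close>
  have no: False
    if "U i j m" "N > 0" "N < k * (k + 1)" "a j ^ N = a i ^ N" "a m ^ N = a i ^ N" for i j m N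
  proof -
    have "a x ^ N = a i ^ N" for x
    proof -
      have "x = i \<or> x = j \<or> x = m" using that(1) by (simp add: U_def)
      then show ?thesis using that(4,5) by auto
    qed
    then have "a x ^ N = a y ^ N" for x y by metis
    then have "k * (k + 1) dvd N" using ord that(2) by blast
    then show False using that(2,3) by (auto dest: dvd_imp_le)
  qed
  have L1: False if "U i j m" "M i i" "M j j" "M m m" for i j m
  proof -
    have "a x ^ (k + 1) = l" if "M x x" for x using R[OF that] by (simp add: mult.commute)
    then show False using no[OF that(1) _ bounds(1)] that by simp
  qed
  have L2: False if "U i j m" "M i i" "M j i" "M m i" for i j m
  proof -
    have "a x ^ k = a i ^ k" if "M x i" for x
      using R[OF that] R[OF \<open>M i i\<close>] nz[of i] by (metis mult_right_cancel)
    then show False using no[OF that(1) pos(1) bounds(2)] that by blast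
  qed
  \<comment> \<open>Raising \<open>a m ^ k * a j = a i ^ k * a i\<close> to the power
    \<open>k\<close> allows \<open>a j ^ k\<close> to be replaced by \<open>a i ^ k\<close>.\<close>
  have L3: False if "U i j m" "M i i" "M j i" "M m j" for i j m
  proof -
    have j: "a j ^ k = a i ^ k"
      using R[OF that(3)] R[OF that(2)] nz[of i] by (metis mult_right_cancel)
    have "a m ^ k * a j = a i ^ k * a i" using R[OF that(4)] R[OF that(2)] by simp
    then have "(a m ^ k * a j) ^ k = (a i ^ k * a i) ^ k" by simp
    then have "a m ^ (k * k) * a i ^ k = a i ^ (k * k) * a i ^ k"
      by (simp only: power_mult_distrib power_mult j)
    then have "a m ^ (k * k) = a i ^ (k * k)" using nz by simp
    moreover have "a j ^ (k * k) = a i ^ (k * k)" by (simp only: power_mult j)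
    ultimately show False using no[OF that(1) _ bounds(3)] pos by simp
  qed
  have swap: "a x ^ q = a y ^ q" if "M x y" "M y x" for x y
  proof -
    have "a x ^ q * (a x * a y) = a y ^ q * (a x * a y)"
      using R[OF that(1)] R[OF that(2)] by (simp add: k mult_ac)
    then show ?thesis using nz by simp
  qed
  \<comment> \<open>The \<open>q\<close>-th power of \<open>a j ^ k * a m = a i ^ k * a i\<close>
    allows \<open>a m ^ q\<close> to be replaced by \<open>a j ^ q\<close>.\<close>
  have L4: False if "U i j m" "M i i" "M j m" "M m j" for i j m
  proof -
    have jm: "a m ^ q = a j ^ q" using swap that by blast
    have "(a j ^ k * a m) ^ q = (a i ^ k * a i) ^ q" using R[OF that(3)] R[OF that(2)] by simp
    then have "a j ^ (k * q) * a j ^ q = a i ^ (k * q) * a i ^ q"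
      by (simp only: power_mult_distrib power_mult jm)
    then have "a j ^ ((k + 1) * q) = a i ^ ((k + 1) * q)" by (simp add: power_add mult.commute)
    moreover have "a m ^ ((k + 1) * q) = a j ^ ((k + 1) * q)"
      by (simp only: mult.commute[of _ q] power_mult jm)
    ultimately show False using no[OF that(1) _ bounds(4)] pos by simp
  qed
  have L5: False if "U i j m" "M i j" "M j m" "M m i" for i j m
  proof -
    define N where "N = q * k + 1"
    \<comment> \<open>Elimination of \<open>a z\<close>: the first two weights give
      \<open>a z * a y ^ q = a x ^ k\<close>. Its \<open>k\<close>-th power is combined with
      \<open>a z ^ k * a x = a x ^ k * a y\<close>.\<close>
    have cyc: "a y ^ N = a x ^ N" if "M x y" "M y z" "M z x" for x y z
    proof -
      have e: "a x ^ q * a x * a y = l" "a y ^ q * a y * a z = l" "a z ^ k * a x = l"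
        using R[OF that(1)] R[OF that(2)] R[OF that(3)] by (simp_all add: k mult_ac)
      have "a y * a z * a y ^ q = a x * a y * a x ^ q" using e by (simp add: mult_ac)
      then have "a z * a y ^ q = a x * a x ^ q" using nz[of y] by (simp add: mult_ac)
      then have "(a z * a y ^ q) ^ k = (a x * a x ^ q) ^ k" by simp
      then have "a z ^ k * a y ^ (q * k) = a x ^ k * a x ^ (q * k)"
        by (simp only: power_mult_distrib power_mult)
      then have "a x * (a z ^ k * a y ^ (q * k)) = a x * (a x ^ k * a x ^ (q * k))"
        by (simp only:)
      moreover have "a x * (a z ^ k * a y ^ (q * k)) = a x ^ k * (a y * a y ^ (q * k))"
        using e(3) R[OF that(1)] by (metis mult.commute mult.assoc)
      ultimately have "a x ^ k * (a y * a y ^ (q * k)) = a x ^ k * (a x * a x ^ (q * k))"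
        by (simp only: mult.left_commute)
      then show ?thesis using nz by (simp add: N_def)
    qed
    have "a j ^ N = a i ^ N" using cyc that by blast
    moreover have "a m ^ N = a i ^ N" using cyc that by metis
    ultimately show False using no[OF that(1) _ bounds(5)] unfolding N_def by simp
  qed
  have L6: False if "U i j m" "M i j" "M j i" "M m i" for i j m
  proof -
    have ij: "a i ^ q = a j ^ q" using swap that by blast
    have "a j ^ k * a i = a m ^ k * a i" using R[OF that(3)] R[OF that(4)] by simp
    then have "a m ^ k = a j ^ k" using nz by simp
    then have "a m ^ (k * q) = a j ^ (k * q)" by (simp only: power_mult)
    moreover have "a i ^ (k * q) = a j ^ (k * q)"
      by (simp only: mult.commute[of _ q] power_mult ij)
    ultimately show False using no[OF that(1) _ bounds(6)] pos by simp
  qed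
  \<comment> \<open>Choosing one \<open>j\<close> with \<open>M i j\<close> for each
    \<open>i\<close> gives a self-map of three points. Up to permutation there are seven:
    \<open>L1\<close> to \<open>L6\<close> exclude six, and the seventh is the claim, whose negation
    is \<open>L0\<close>.\<close>
  have "\<exists>i j m. U i j m \<and> M i i \<and> M j j \<and> M m i"
  proof (rule ccontr)
    assume "\<not> ?thesis"
    then have L0: False if "U i j m" "M i i" "M j j" "M m i" for i j m using that by blast
    have row: "M i 1 \<or> M i 2 \<or> M i 3" for i using M[of i] exhaust_3 by metis
    note rules = perm[THEN L0] perm[THEN L1] perm[THEN L2] perm[THEN L3] perm[THEN L4]
      perm[THEN L5] perm[THEN L6]
    show False
      by (insert row[of 1] row[of 2] row[of 3], elim disjE; (rule rules; assumption))
  qed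
  then show ?thesis using that unfolding U_def by blast
qed

section \<open>Linear substitutions as ring homomorphisms\<close>

lemma Const3_power: "Const3 c ^ n = Const3 (c ^ n)"
  by (induction n) (simp_all add: Const3.h_1 Const3.h_mult)

lemma Const3_prod: "(\<Prod>i\<in>S. Const3 (f i)) = Const3 (\<Prod>i\<in>S. f i)"
  by (induction S rule: infinite_finite_induct) (simp_all add: Const3.h_1 Const3.h_mult)

lemma homogeneous3_0: "homogeneous3 n 0"
  by (simp add: homogeneous3_def)

lemma homogeneous3_add: "homogeneous3 n F \<Longrightarrow> homogeneous3 n G \<Longrightarrow> homogeneous3 n (F + G)"
  unfolding homogeneous3_def using Poly_Mapping.keys_add[of F G] by blast

lemma homogeneous3_sum: "(\<And>x. x \<in> S \<Longrightarrow> homogeneous3 n (f x)) \<Longrightarrow> homogeneous3 n (\<Sum>x\<in>S. f x)"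
  by (induction S rule: infinite_finite_induct) (auto simp: homogeneous3_0 homogeneous3_add)

lemma homogeneous3_mult:
  assumes "homogeneous3 m F" "homogeneous3 n G"
  shows "homogeneous3 (m + n) (F * G)"
  unfolding homogeneous3_def
proof
  fix a assume "a \<in> Poly_Mapping.keys (F * G)"
  then obtain b c where "a = b + c" "b \<in> Poly_Mapping.keys F" "c \<in> Poly_Mapping.keys G"
    using keys_mult[of F G] by auto
  then show "(\<Sum>i\<in>UNIV. Poly_Mapping.lookup a i) = m + n"
    using assms by (simp add: homogeneous3_def lookup_add sum.distrib)
qed

lemma homogeneous3_Const3: "homogeneous3 0 (Const3 c)"
  by (simp add: homogeneous3_def Const3_def)

lemma homogeneous3_Var3: "homogeneous3 1 (Var3 i :: 'a::comm_ring_1 poly3)"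
  by (simp add: homogeneous3_def Var3_def lookup_single when_def)

lemma homogeneous3_power: "homogeneous3 m F \<Longrightarrow> homogeneous3 (m * k) (F ^ k)"
proof (induction k)
  case 0
  then show ?case using homogeneous3_Const3[of 1] by (simp add: Const3.h_1)
qed (simp add: homogeneous3_mult)

lemma homogeneous3_prod:
  "(\<And>x. x \<in> S \<Longrightarrow> homogeneous3 (e x) (f x)) \<Longrightarrow> homogeneous3 (sum e S) (prod f S)"
proof (induction S rule: infinite_finite_induct)
  case (insert x S)
  then show ?case by (simp add: homogeneous3_mult)
qed (use homogeneous3_Const3[of 1] in \<open>simp_all add: Const3.h_1\<close>)

lemma homogeneous3_linear_subst:
  assumes "homogeneous3 d F"
  shows "homogeneous3 d (linear_subst A F)"
  unfolding linear_subst_def insert3_def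
proof (rule homogeneous3_sum)
  fix m assume "m \<in> Poly_Mapping.keys F"
  \<comment> \<open>The padding by \<open>0 +\<close> and \<open>1 *\<close> gives the degree the
    shape that the homogeneity rules build.\<close>
  then have d: "0 + (\<Sum>i\<in>UNIV. 1 * Poly_Mapping.lookup m i) = d"
    using assms by (simp add: homogeneous3_def)
  have "homogeneous3 (0 + 1) (Const3 (A $ i $ j) * Var3 j)" for i j
    by (intro homogeneous3_mult homogeneous3_Const3 homogeneous3_Var3)
  then have "homogeneous3 1 (\<Sum>j\<in>UNIV. Const3 (A $ i $ j) * Var3 j)" for i
    by (intro homogeneous3_sum) simp
  then show "homogeneous3 d (Const3 (Poly_Mapping.lookup F m) *
      (\<Prod>i\<in>UNIV. (\<Sum>j\<in>UNIV. Const3 (A $ i $ j) * Var3 j) ^ Poly_Mapping.lookup m i))"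
    by (subst d[symmetric]) (intro homogeneous3_mult homogeneous3_Const3 homogeneous3_prod homogeneous3_power)
qed

lemma lookup_Const3_mult: "Poly_Mapping.lookup (Const3 c * F) m = c * Poly_Mapping.lookup F m"
proof -
  have "Const3 c * F = (\<Sum>n\<in>Poly_Mapping.keys F. Poly_Mapping.single n (c * Poly_Mapping.lookup F n))"
    by (subst Const3.poly3_as_sum[of F]) (simp add: Const3_def sum_distrib_left mult_single)
  then show ?thesis
    by (simp add: lookup_sum lookup_single when_def in_keys_iff)
qed

section \<open>Diagonal substitutions and conjugation\<close>

definition diag_matrix :: "('n \<Rightarrow> 'a) \<Rightarrow> 'a::zero^'n^'n" where
  "diag_matrix a = (\<chi> i j. if i = j then a i else 0)"

lemma diag_matrix_mult: "diag_matrix a ** diag_matrix b = diag_matrix (\<lambda>i. a i * b i :: 'a::comm_ring_1)"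
  by (simp add: diag_matrix_def matrix_matrix_mult_def vec_eq_iff if_distrib[of "\<lambda>x. x * _"] cong: if_cong)

lemma diag_matrix_const: "diag_matrix (\<lambda>_. c) = mat c"
  by (simp add: diag_matrix_def mat_def)

lemma mult_diag_matrix_eq_iff:
  fixes A P :: "'a::comm_ring_1^'n^'n"
  shows "A ** P = P ** diag_matrix a \<longleftrightarrow> (\<forall>i. A *v column i P = a i *s column i P)"
proof -
  have "(P ** diag_matrix a) $ k $ i = a i * P $ k $ i" for i k
    by (simp add: matrix_matrix_mult_def diag_matrix_def if_distrib mult.commute cong: if_cong)
  moreover have "(A ** P) $ k $ i = (A *v column i P) $ k" for i k
    by (simp add: matrix_matrix_mult_def matrix_vector_mult_def column_def)
  ultimately show ?thesis by (auto simp: vec_eq_iff column_def)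
qed

lemma linear_subst_Var3: "linear_subst A (Var3 i) = (\<Sum>j\<in>UNIV. Const3 (A $ i $ j) * Var3 j)"
  by (simp add: linear_subst_def Const3.insert3_Var3)

lemma linear_subst_diag_Var3: "linear_subst (diag_matrix a) (Var3 i) = Const3 (a i) * Var3 i"
proof -
  have "linear_subst (diag_matrix a) (Var3 i) = (\<Sum>j\<in>UNIV. if i = j then Const3 (a j) * Var3 j else 0)"
    unfolding linear_subst_Var3
    by (intro sum.cong) (auto simp: diag_matrix_def Const3.h_0)
  then show ?thesis by simp
qed

lemma linear_subst_add: "linear_subst A (F + G) = linear_subst A F + linear_subst A G"
  and linear_subst_mul: "linear_subst A (F * G) = linear_subst A F * linear_subst A G"
  and linear_subst_power: "linear_subst A (F ^ n) = linear_subst A F ^ n"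
  and linear_subst_Const3: "linear_subst A (Const3 c) = Const3 c"
  by (simp_all add: linear_subst_def Const3.insert3_add Const3.insert3_mult Const3.insert3_power
      Const3.insert3_Const3)

text \<open>Each monomial is multiplied by its weight. Hence all monomials of a form preserved up to
  a scalar have the same weight.\<close>

lemma lookup_linear_subst_diag:
  "Poly_Mapping.lookup (linear_subst (diag_matrix a) F) m
     = (\<Prod>i\<in>UNIV. a i ^ Poly_Mapping.lookup m i) * Poly_Mapping.lookup F m"
proof -
  have "linear_subst (diag_matrix a) F = (\<Sum>m\<in>Poly_Mapping.keys F. Const3 (Poly_Mapping.lookup F m) *
      (\<Prod>i\<in>UNIV. (Const3 (a i) * Var3 i) ^ Poly_Mapping.lookup m i))"
    by (simp only: linear_subst_def[of _ F] insert3_def[of _ _ F] linear_subst_diag_Var3 flip: linear_subst_Var3)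
  also have "\<dots> = (\<Sum>m\<in>Poly_Mapping.keys F. Const3 (Poly_Mapping.lookup F m *
      (\<Prod>i\<in>UNIV. a i ^ Poly_Mapping.lookup m i)) * (\<Prod>i\<in>UNIV. Var3 i ^ Poly_Mapping.lookup m i))"
    by (simp add: power_mult_distrib prod.distrib Const3_power Const3_prod Const3.h_mult mult.assoc)
  finally show ?thesis
    unfolding monomial_Var3 by (simp add: lookup_sum lookup_single when_def in_keys_iff mult.commute)
qed

lemma Var3_power: "Var3 i ^ n = (Poly_Mapping.single (Poly_Mapping.single i n) 1 :: 'a::comm_ring_1 poly3)"
  by (induction n) (auto simp: Var3_def mult_single simp flip: single_add)

text \<open>Automorphisms move along a projective equivalence by conjugation, since
  \<open>P ** (Q ** A ** P) = A ** P\<close>; the scalar \<open>p\<close> cancels.\<close>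

lemma preserves_form_conj:
  fixes F :: "'a::field poly3"
  assumes "linear_subst P F = Const3 p * G" "p \<noteq> 0" "P ** Q = mat 1" "preserves_form F A"
  shows "preserves_form G (Q ** A ** P)"
proof -
  obtain c where c: "c \<noteq> 0" "linear_subst A F = Const3 c * F"
    using assms(4) by (auto simp: preserves_form_def)
  let ?B = "Q ** A ** P"
  have PB: "P ** ?B = A ** P" using assms(3) by (simp add: matrix_mul_assoc)
  have "Const3 p * linear_subst ?B G = linear_subst ?B (linear_subst P F)"
    by (simp add: assms(1) linear_subst_Const3_mult)
  also have "\<dots> = linear_subst P (linear_subst A F)"
    by (simp add: linear_subst_mult PB)
  also have "\<dots> = Const3 p * (Const3 c * G)"
    by (simp add: c(2) linear_subst_Const3_mult assms(1) mult.left_commute)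
  finally have "Const3 (inverse p) * (Const3 p * linear_subst ?B G)
      = Const3 (inverse p) * (Const3 p * (Const3 c * G))" by simp
  then have "linear_subst ?B G = Const3 c * G"
    using assms(2) by (simp add: Const3.h_1 flip: mult.assoc Const3.h_mult)
  then show ?thesis using c(1) by (auto simp: preserves_form_def)
qed

lemma proj_equivalent_inverse:
  fixes F :: "'a::field poly3"
  assumes "linear_subst P F = Const3 p * G" "p \<noteq> 0" "P ** Q = mat 1"
  shows "linear_subst Q G = Const3 (inverse p) * F"
proof -
  have "F = linear_subst Q (linear_subst P F)"
    by (simp add: linear_subst_mult assms(3) linear_subst_one)
  also have "\<dots> = Const3 p * linear_subst Q G" by (simp add: assms(1) linear_subst_Const3_mult)
  finally have "Const3 (inverse p) * F = Const3 (inverse p) * (Const3 p * linear_subst Q G)" by simp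
  then show ?thesis using assms(2) by (simp add: Const3.h_1 flip: mult.assoc Const3.h_mult)
qed

section \<open>Orders of projectivities\<close>

lemma carrier_GL3: "carrier GL3 = {A. invertible A}"
  and mult_GL3: "A \<otimes>\<^bsub>GL3\<^esub> B = A ** B"
  by (simp_all add: GL3_def)

text \<open>Connects group powers with the iterates in \<open>ex_eigenbasis\<close>.\<close>

lemma pow_GL3_mult_vec: "(A [^]\<^bsub>GL3\<^esub> (n :: nat)) *v v = ((*v) A ^^ n) v" for A :: "'a::field^3^3"
proof (induction n arbitrary: v)
  case (Suc n)
  have "(A [^]\<^bsub>GL3\<^esub> Suc n) *v v = (A [^]\<^bsub>GL3\<^esub> n) *v (A *v v)"
    by (simp add: mult_GL3 matrix_vector_mul_assoc)
  then show ?case by (simp only: Suc.IH funpow_Suc_right comp_apply)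
qed (simp add: GL3_def)

lemma mat_mult_vec: "mat c *v v = c *s v" for v :: "'a::comm_ring_1^'n"
  by (simp add: mat_def matrix_vector_mult_def vec_eq_iff if_distrib[of "\<lambda>x. x * _"] cong: if_cong)

lemma pow_GL3_in_scalars3_iff:
  fixes A :: "'a::field^3^3"
  shows "A [^]\<^bsub>GL3\<^esub> (n :: nat) \<in> scalars3 \<longleftrightarrow> (\<exists>c. c \<noteq> 0 \<and> (\<forall>v. ((*v) A ^^ n) v = c *s v))"
  by (auto simp: scalars3_def matrix_eq mat_mult_vec pow_GL3_mult_vec)

lemma funpow_eigenvector:
  fixes A :: "'a::field^'n^'n"
  assumes "A *v v = a *s v"
  shows "((*v) A ^^ n) v = a ^ n *s v"
  by (induction n) (simp_all add: vector_scalar_commute assms mult.commute)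

lemma funpow_mult_vec_sum: "((*v) A ^^ n) (\<Sum>x\<in>S. f x) = (\<Sum>x\<in>S. ((*v) A ^^ n) (f x))"
  and funpow_mult_vec_scale: "((*v) A ^^ n) (c *s v) = c *s ((*v) A ^^ n) v"
  for A :: "'a::field^'n^'n"
  by (induction n) (simp_all add: matrix_vector_mult_sum vector_scalar_commute)

lemma column_nonzero: "invertible P \<Longrightarrow> column i P \<noteq> 0" for P :: "'a::field^'n^'n"
proof
  assume "invertible P" "column i P = 0"
  then obtain Q where Q: "Q ** P = mat 1" by (auto simp: invertible_def)
  have "(Q ** P) $ i $ i = (Q *v column i P) $ i"
    by (simp add: matrix_matrix_mult_def matrix_vector_mult_def column_def)
  then show False using Q \<open>column i P = 0\<close> by (simp add: mat_def)
qed

text \<open>Orders in \<open>PGL3\<close> thus depend only on the ratios of the eigenvalues.\<close>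

lemma pow_eigenbasis_in_scalars3_iff:
  fixes A P :: "'a::field^3^3"
  assumes P: "invertible P" and ev: "\<And>i. A *v column i P = a i *s column i P"
    and nz: "\<And>i. a i \<noteq> 0"
  shows "A [^]\<^bsub>GL3\<^esub> (n :: nat) \<in> scalars3 \<longleftrightarrow> (\<forall>i j. a i ^ n = a j ^ n)"
  unfolding pow_GL3_in_scalars3_iff
proof
  assume "\<exists>c. c \<noteq> 0 \<and> (\<forall>v. ((*v) A ^^ n) v = c *s v)"
  then obtain c where c: "\<And>v. ((*v) A ^^ n) v = c *s v" by blast
  have "a i ^ n = c" for i
    using c[of "column i P"] funpow_eigenvector[OF ev, of n i] column_nonzero[OF P, of i] by simp
  then show "\<forall>i j. a i ^ n = a j ^ n" by simp
next
  assume eq: "\<forall>i j. a i ^ n = a j ^ n"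
  obtain Q where Q: "P ** Q = mat 1" using P by (auto simp: invertible_def)
  define c where "c = a 1 ^ n"
  have c: "a i ^ n = c" for i using eq unfolding c_def by blast
  have "((*v) A ^^ n) v = c *s v" for v
  proof -
    have v: "(\<Sum>i\<in>UNIV. (Q *v v) $ i *s column i P) = v"
      using matrix_mult_sum[of P "Q *v v"] Q by (simp add: matrix_vector_mul_assoc)
    have "((*v) A ^^ n) (\<Sum>i\<in>UNIV. (Q *v v) $ i *s column i P)
        = c *s (\<Sum>i\<in>UNIV. (Q *v v) $ i *s column i P)"
      by (simp add: funpow_mult_vec_sum funpow_mult_vec_scale funpow_eigenvector[OF ev] c
          vec.scale_sum_right mult.commute)
    then show ?thesis by (simp only: v)
  qed
  moreover have "c \<noteq> 0" using nz by (simp add: c_def)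
  ultimately show "\<exists>c. c \<noteq> 0 \<and> (\<forall>v. ((*v) A ^^ n) v = c *s v)" by blast
qed

abbreviation proj_class :: "'a::field^3^3 \<Rightarrow> ('a^3^3) set" where
  "proj_class A \<equiv> scalars3 #>\<^bsub>GL3\<^esub> A"

lemma carrier_curve_Aut: "carrier (curve_Aut F) = {proj_class A | A. invertible A \<and> preserves_form F A}"
  by (simp add: curve_Aut_def carrier_GL3)

lemma proj_class_mult_scalar:
  assumes "c \<noteq> 0" "invertible A"
  shows "proj_class (mat c ** A) = proj_class A"
proof -
  interpret group "GL3 :: ('a::field^3^3) monoid" by (rule group_GL3)
  have sub: "subgroup scalars3 (GL3 :: ('a^3^3) monoid)"
    using normal_scalars3 normal_imp_subgroup by blast
  have "mat c ** A \<in> proj_class A"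
    using assms by (auto simp: r_coset_def scalars3_def mult_GL3)
  then show ?thesis
    using repr_independence[of "mat c ** A" scalars3 A] sub assms(2) by (simp add: carrier_GL3)
qed

text \<open>\<open>curve_Aut F\<close> multiplies as \<open>PGL3\<close> does: powers of a class are
  classes of powers, and the unit is the coset of scalars.\<close>

lemma proj_class_pow_eq_one_iff:
  fixes A :: "'a::field^3^3"
  assumes "invertible A"
  shows "proj_class A [^]\<^bsub>curve_Aut F\<^esub> (n :: nat) = \<one>\<^bsub>curve_Aut F\<^esub> \<longleftrightarrow> A [^]\<^bsub>GL3\<^esub> n \<in> scalars3"
proof -
  interpret group "GL3 :: ('a^3^3) monoid" by (rule group_GL3)
  have sub: "subgroup scalars3 (GL3 :: ('a^3^3) monoid)"
    using normal_scalars3 normal_imp_subgroup by blast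
  have A: "A \<in> carrier GL3" using assms by (simp add: carrier_GL3)
  have one: "\<one>\<^bsub>curve_Aut F\<^esub> = (scalars3 :: ('a^3^3) set)"
    by (simp add: curve_Aut_def PGL3_def FactGroup_def)
  have "proj_class A [^]\<^bsub>curve_Aut F\<^esub> n = proj_class (A [^]\<^bsub>GL3\<^esub> n)"
  proof (induction n)
    case 0
    have "proj_class \<one>\<^bsub>GL3\<^esub> = (scalars3 :: ('a^3^3) set)"
      using coset_mult_one[of scalars3] subgroup.subset[OF sub] by simp
    then show ?case by (simp add: one)
  next
    case (Suc n)
    then show ?case
      using normal.rcos_sum[OF normal_scalars3 nat_pow_closed[OF A, of n] A]
      by (simp add: curve_Aut_def PGL3_def FactGroup_def)
  qed
  moreover have "proj_class B = scalars3 \<longleftrightarrow> B \<in> scalars3" if "B \<in> carrier GL3" for B :: "'a^3^3"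
    using coset_join1[OF _ that sub] coset_join2[OF that sub] by blast
  ultimately show ?thesis using A by (simp add: one)
qed

lemma group_ord_eqI:
  assumes "group G" "g \<in> carrier G" "\<And>n :: nat. g [^]\<^bsub>G\<^esub> n = \<one>\<^bsub>G\<^esub> \<longleftrightarrow> m dvd n"
  shows "group.ord G g = m"
  using assms by (metis group.pow_eq_id dvd_antisym dvd_refl)

section \<open>Pairs of roots of unity of coprime orders\<close>

lemma primitive_root_of_unity_pair_iff:
  assumes "primitive_root_of_unity m b" "primitive_root_of_unity n c" "coprime m n"
  shows "b ^ k = 1 \<and> c ^ k = 1 \<longleftrightarrow> m * n dvd k"
  using assms unfolding primitive_root_of_unity_def
  by (metis divides_mult dvd_mult_left dvd_mult_right)

text \<open>The powers with exponents \<open>n\<close> and \<open>m\<close> remove one factor each,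
  and coprimality then removes these exponents from the divisibilities.\<close>

lemma primitive_root_of_unity_mult_eq_1:
  fixes b c :: "'a::field"
  assumes b: "primitive_root_of_unity m b" and c: "primitive_root_of_unity n c"
    and "coprime m n" and eq: "b ^ i * c ^ j = 1"
  shows "m dvd i" "n dvd j"
proof -
  have bm: "b ^ m = 1" and cn: "c ^ n = 1"
    using b c by (auto simp: primitive_root_of_unity_def)
  have "(b ^ i * c ^ j) ^ n = b ^ (i * n) * (c ^ n) ^ j"
    by (simp only: power_mult_distrib mult.commute[of j n] flip: power_mult)
  then have "b ^ (i * n) = 1" by (simp add: eq cn)
  then have "m dvd i * n" using b by (simp add: primitive_root_of_unity_def)
  then show "m dvd i" using assms(3) by (simp add: coprime_dvd_mult_left_iff)
  have "(b ^ i * c ^ j) ^ m = (b ^ m) ^ i * c ^ (j * m)"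
    by (simp only: power_mult_distrib mult.commute[of i m] flip: power_mult)
  then have "c ^ (j * m) = 1" by (simp add: eq bm)
  then have "n dvd j * m" using c by (simp add: primitive_root_of_unity_def)
  then show "n dvd j" using assms(3) by (simp add: coprime_dvd_mult_left_iff coprime_commute)
qed

text \<open>If \<open>b ^ i = 1\<close>, then \<open>i * n\<close> kills both \<open>b\<close> and
  \<open>c\<close>, so \<open>m * n\<close> divides it; likewise \<open>m * i\<close> for
  \<open>c\<close>.\<close>

lemma primitive_roots_of_unityI:
  fixes b c :: "'a::field"
  assumes "m > 0" "n > 0" "b ^ m = 1" "c ^ n = 1"
    and ord: "\<And>k. k > 0 \<Longrightarrow> b ^ k = 1 \<Longrightarrow> c ^ k = 1 \<Longrightarrow> m * n dvd k"
  shows "primitive_root_of_unity m b" "primitive_root_of_unity n c"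
proof -
  have "m dvd i" if "b ^ i = 1" for i
  proof (cases "i = 0")
    case False
    have "b ^ (i * n) = 1" using that by (simp only: power_mult power_one)
    moreover have "c ^ (i * n) = 1"
      using assms(4) by (simp only: mult.commute[of i n] power_mult power_one)
    ultimately have "m * n dvd i * n" using ord[of "i * n"] False assms(2) by simp
    then show ?thesis using assms(2) by simp
  qed simp
  then show "primitive_root_of_unity m b" using assms(3) by (intro primitive_root_of_unityI)
  have "n dvd i" if "c ^ i = 1" for i
  proof (cases "i = 0")
    case False
    have "b ^ (m * i) = 1" using assms(3) by (simp only: power_mult power_one)
    moreover have "c ^ (m * i) = 1"
      using that by (simp only: mult.commute[of m i] power_mult power_one)
    ultimately have "m * n dvd m * i" using ord[of "m * i"] False assms(1) by simp
    then show ?thesis using assms(1) by simp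
  qed simp
  then show "primitive_root_of_unity n c" using assms(4) by (intro primitive_root_of_unityI)
qed

section \<open>The automorphism group of the normal form\<close>

lemma eval3_homology_form:
  "eval3 (Var3 1 ^ d + Var3 2 ^ d + Const3 \<alpha> * Var3 1 * Var3 3 ^ (d - 1)) x = homology_form d \<alpha> x"
  by (simp add: eval3_def homology_form_def id3.insert3_add id3.insert3_mult id3.insert3_power
      id3.insert3_Const3 id3.insert3_Var3)

text \<open>The first entry is normalised to 1, which picks one diagonal matrix from each class
  modulo scalars.\<close>

definition diag_tuple :: "'a::comm_ring_1 \<Rightarrow> 'a \<Rightarrow> 3 \<Rightarrow> 'a" where
  "diag_tuple b c i = (if i = 1 then 1 else if i = 2 then b else c)"

lemma diag_tuple_simps [simp]: "diag_tuple b c 1 = 1" "diag_tuple b c 2 = b" "diag_tuple b c 3 = c"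
  by (simp_all add: diag_tuple_def)

lemma invertible_diag_matrix:
  fixes a :: "'n::finite \<Rightarrow> 'a::field"
  assumes "\<And>i. a i \<noteq> 0"
  shows "invertible (diag_matrix a)"
proof -
  have "diag_matrix a ** diag_matrix (\<lambda>i. inverse (a i)) = mat 1"
    using assms by (simp add: diag_matrix_mult diag_matrix_const)
  then show ?thesis by (auto simp: invertible_right_inverse)
qed

lemma homology_form_diag_preserved:
  fixes b c :: "'a::field"
  assumes "b ^ d = 1" "c ^ (d - 1) = 1"
  shows "preserves_form (Var3 1 ^ d + Var3 2 ^ d + Const3 \<alpha> * Var3 1 * Var3 3 ^ (d - 1))
    (diag_matrix (diag_tuple b c))"
proof -
  show ?thesis unfolding preserves_form_def
    using assms by (intro exI[of _ 1]) (simp add: linear_subst_add linear_subst_mul linear_subst_power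
      linear_subst_Const3 linear_subst_diag_Var3 power_mult_distrib Const3_power Const3.h_1)
qed

text \<open>The element of order \<open>d * (d - 1)\<close>: its eigenvalue ratios \<open>b\<close>
  and \<open>c\<close> have the coprime orders \<open>d\<close> and \<open>d - 1\<close>.\<close>

lemma proj_class_diag_ord:
  fixes F :: "'a::field poly3"
  assumes "d \<ge> 2" "linear_subst P F = Const3 p * (Var3 1 ^ d + Var3 2 ^ d + Const3 \<alpha> * Var3 1 * Var3 3 ^ (d - 1))"
    and "p \<noteq> 0" "P ** Q = mat 1" "Q ** P = mat 1"
    and b: "primitive_root_of_unity d b" and c: "primitive_root_of_unity (d - 1) c"
  shows "proj_class (P ** diag_matrix (diag_tuple b c) ** Q) \<in> carrier (curve_Aut F)"
    and "group.ord (curve_Aut F) (proj_class (P ** diag_matrix (diag_tuple b c) ** Q)) = d * (d - 1)"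
proof -
  let ?D = "diag_matrix (diag_tuple b c)"
  let ?A = "P ** ?D ** Q"
  have bd: "b ^ d = 1" and cd: "c ^ (d - 1) = 1"
    using b c by (simp_all add: primitive_root_of_unity_def)
  have nz: "diag_tuple b c i \<noteq> 0" for i
    using bd cd assms(1) by (auto simp: diag_tuple_def power_0_left)
  have "preserves_form F ?A"
    using preserves_form_conj[OF proj_equivalent_inverse[OF assms(2-4)] _ assms(5)
        homology_form_diag_preserved[OF bd cd]] assms(3) by simp
  moreover have P: "invertible P" "invertible Q" using assms(4,5) by (auto simp: invertible_def)
  then have A: "invertible ?A" using invertible_diag_matrix nz by (intro invertible_mult) auto
  ultimately show mem: "proj_class ?A \<in> carrier (curve_Aut F)" by (auto simp: carrier_curve_Aut)
  have "?A ** P = P ** ?D" using assms(5) by (metis matrix_mul_assoc matrix_mul_rid)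
  then have ev: "\<And>i. ?A *v column i P = diag_tuple b c i *s column i P"
    by (simp add: mult_diag_matrix_eq_iff)
  have co: "coprime d (d - 1)" using assms(1) by (metis Suc_diff_1 coprime_Suc_left_nat less_le_trans pos2)
  have "(\<forall>i j. diag_tuple b c i ^ n = diag_tuple b c j ^ n) \<longleftrightarrow> b ^ n = 1 \<and> c ^ n = 1" for n
    unfolding forall_3 by auto
  then have "(\<forall>i j. diag_tuple b c i ^ n = diag_tuple b c j ^ n) \<longleftrightarrow> d * (d - 1) dvd n" for n
    by (simp only: primitive_root_of_unity_pair_iff[OF b c co])
  then have "proj_class ?A [^]\<^bsub>curve_Aut F\<^esub> n = \<one>\<^bsub>curve_Aut F\<^esub> \<longleftrightarrow> d * (d - 1) dvd n" for n :: nat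
    unfolding proj_class_pow_eq_one_iff[OF A] pow_eigenbasis_in_scalars3_iff[OF P(1) ev nz] .
  then show "group.ord (curve_Aut F) (proj_class ?A) = d * (d - 1)"
    by (rule group_ord_eqI[OF group_curve_Aut mem])
qed

text \<open>\<open>B\<close> is diagonal, so values of the form at a few vectors determine the
  entries up to the common factor \<open>t\<close>.\<close>

lemma homology_form_preserved_imp_diag:
  fixes B :: "'a::field_char_0^3^3"
  assumes "d \<ge> 5" "\<alpha> \<noteq> 0" "invertible B"
    and "preserves_form (Var3 1 ^ d + Var3 2 ^ d + Const3 \<alpha> * Var3 1 * Var3 3 ^ (d - 1)) B"
  obtains t b c where "t \<noteq> 0" "b ^ d = 1" "c ^ (d - 1) = 1" "B = mat t ** diag_matrix (diag_tuple b c)"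
proof -
  let ?G = "Var3 1 ^ d + Var3 2 ^ d + Const3 \<alpha> * Var3 1 * Var3 3 ^ (d - 1)"
  obtain l where l: "l \<noteq> 0" "linear_subst B ?G = Const3 l * ?G"
    using assms(4) by (auto simp: preserves_form_def)
  have eq: "homology_form d \<alpha> (B *v x) = l * homology_form d \<alpha> x" for x
  proof -
    have "eval3 (linear_subst B ?G) x = eval3 (Const3 l * ?G) x" by (simp only: l)
    moreover have "eval3 (Const3 l * ?G) x = l * eval3 ?G x"
      by (simp only: eval3_def id3.insert3_mult id3.insert3_Const3)
    ultimately show ?thesis by (simp only: eval3_linear_subst eval3_homology_form)
  qed
  have off: "B $ i $ j = 0" if "i \<noteq> j" for i j
    using homology_form_automorphism_diagonal[OF assms(1-3) eq that] .
  have Bx: "(B *v x) $ i = B $ i $ i * x $ i" for x i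
  proof -
    have "(B *v x) $ i = (\<Sum>j\<in>UNIV. if j = i then B $ i $ i * x $ i else 0)"
      unfolding matrix_vector_mult_def vec_lambda_beta by (intro sum.cong) (auto simp: off)
    then show ?thesis by simp
  qed
  have e1: "B $ 1 $ 1 ^ d = l" using eq[of "axis 1 1"] assms(1)
    by (simp add: homology_form_def Bx axis_def power_0_left)
  have e2: "B $ 2 $ 2 ^ d = l" using eq[of "axis 2 1"] assms(1)
    by (simp add: homology_form_def Bx axis_def power_0_left)
  \<comment> \<open>The form vanishes at \<open>axis 3 1\<close>, so \<open>axis 1 1\<close> is
    added to see the mixed monomial.\<close>
  have e3: "B $ 1 $ 1 * B $ 3 $ 3 ^ (d - 1) = l"
    using eq[of "axis 1 1 + axis 3 1"] assms(1,2)
    by (simp add: homology_form_def Bx axis_def power_0_left e1 algebra_simps)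
  let ?t = "B $ 1 $ 1" and ?b = "B $ 2 $ 2 / B $ 1 $ 1" and ?c = "B $ 3 $ 3 / B $ 1 $ 1"
  have t: "?t \<noteq> 0" using e1 l(1) assms(1) by (auto simp: power_0_left)
  have "?b ^ d = 1" using e1 e2 l(1) by (simp add: power_divide)
  moreover have "?c ^ (d - 1) = 1"
  proof -
    have "?t * ?t ^ (d - 1) = l" using e1 assms(1) by (simp add: power_eq_if)
    then have "B $ 3 $ 3 ^ (d - 1) = ?t ^ (d - 1)" using e3 t by (metis mult_left_cancel)
    then show ?thesis using t by (simp add: power_divide)
  qed
  moreover have "B = mat ?t ** diag_matrix (diag_tuple ?b ?c)"
    using t off by (simp add: diag_matrix_mult flip: diag_matrix_const)
      (simp add: diag_matrix_def vec_eq_iff forall_3)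
  ultimately show ?thesis using that t by blast
qed

section \<open>Counting the automorphisms for \<open>d \<ge> 5\<close>\<close>

lemma card_nth_roots_of_unity_le:
  assumes "n > 0"
  shows "finite {x :: 'a::idom. x ^ n = 1}" "card {x :: 'a::idom. x ^ n = 1} \<le> n"
proof -
  define p :: "'a poly" where "p = Polynomial.monom 1 n - 1"
  have r: "{x. poly p x = 0} = {x. x ^ n = 1}" by (auto simp: p_def poly_monom)
  have "Polynomial.coeff p n = 1" using assms by (simp add: p_def)
  then have p: "p \<noteq> 0" by auto
  show "finite {x :: 'a. x ^ n = 1}" using poly_roots_finite[OF p] by (simp add: r)
  have "Polynomial.degree p \<le> n" unfolding p_def by (intro degree_diff_le degree_monom_le) simp
  then show "card {x :: 'a. x ^ n = 1} \<le> n" using card_poly_roots_bound[OF p] by (simp add: r)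
qed

lemma (in group) cyclic_group_if_ord_ge:
  assumes "finite (carrier G)" "g \<in> carrier G" "card (carrier G) \<le> ord g"
  shows "cyclic_group G" "order G = ord g"
proof -
  have sub: "generate G {g} \<subseteq> carrier G" using assms(2) by (intro generate_incl) simp
  have "card (generate G {g}) = card (carrier G)"
    using card_mono[OF assms(1) sub] assms(3) generate_pow_card[OF assms(2)] by simp
  then have carrier: "generate G {g} = carrier G" by (rule card_subset_eq[OF assms(1) sub])
  have "carrier G = range (\<lambda>n::int. g [^] n)"
    unfolding carrier[symmetric] generate_pow[OF assms(2)] by auto
  then show "cyclic_group G" using assms(2) unfolding cyclic_group by blast
  show "order G = ord g"
    using carrier generate_pow_card[OF assms(2)] by (simp add: order_def)
qed

text \<open>There are at most \<open>d * (d - 1)\<close> diagonal automorphisms up to scalars, and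
  one element already has that order, so it generates the group.\<close>

lemma curve_Aut_cyclic:
  fixes F :: "'k::{alg_closed_field, field_char_0} poly3"
  assumes "d \<ge> 5" "\<alpha> \<noteq> 0" and P: "linear_subst P F
      = Const3 p * (Var3 1 ^ d + Var3 2 ^ d + Const3 \<alpha> * Var3 1 * Var3 3 ^ (d - 1))"
    and "p \<noteq> 0" "P ** Q = mat 1" "Q ** P = mat 1"
  shows "cyclic_group (curve_Aut F)" "order (curve_Aut F) = d * (d - 1)"
proof -
  obtain b c :: 'k where bc: "primitive_root_of_unity d b" "primitive_root_of_unity (d - 1) c"
    using ex_primitive_root_of_unity[of d] ex_primitive_root_of_unity[of "d - 1"] assms(1) by auto
  define g where "g = proj_class (P ** diag_matrix (diag_tuple b c) ** Q)"
  have g: "g \<in> carrier (curve_Aut F)" "group.ord (curve_Aut F) g = d * (d - 1)"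
    unfolding g_def using proj_class_diag_ord[OF _ P assms(4-6) bc] assms(1) by simp_all
  define R where "R = {b :: 'k. b ^ d = 1} \<times> {c :: 'k. c ^ (d - 1) = 1}"
  let ?f = "\<lambda>(b, c). proj_class (P ** diag_matrix (diag_tuple b c) ** Q)"
  have "carrier (curve_Aut F) \<subseteq> ?f ` R"
  proof
    fix h assume "h \<in> carrier (curve_Aut F)"
    then obtain A where A: "h = proj_class A" "invertible A" "preserves_form F A"
      by (auto simp: carrier_curve_Aut)
    have inv: "invertible P" "invertible Q" using assms(5,6) by (auto simp: invertible_def)
    have "invertible (Q ** A ** P)" using A(2) inv by (intro invertible_mult)
    from homology_form_preserved_imp_diag[OF assms(1,2) this preserves_form_conj[OF P assms(4,5) A(3)]]
    obtain t b c where tbc: "t \<noteq> 0" "b ^ d = 1" "c ^ (d - 1) = 1"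
      "Q ** A ** P = mat t ** diag_matrix (diag_tuple b c)" .
    let ?E = "P ** diag_matrix (diag_tuple b c) ** Q"
    \<comment> \<open>The conjugation is undone; the central scalar \<open>mat t\<close> moves to
      the front and disappears in the class.\<close>
    have "A = (P ** Q) ** A ** (P ** Q)" by (simp add: assms(5))
    also have "\<dots> = P ** (Q ** A ** P) ** Q" by (simp only: matrix_mul_assoc)
    also have "\<dots> = (P ** mat t) ** diag_matrix (diag_tuple b c) ** Q"
      by (simp only: tbc(4) matrix_mul_assoc)
    also have "\<dots> = mat t ** ?E"
      by (simp only: mat_mult_commute[of t P, symmetric] matrix_mul_assoc)
    finally have AE: "A = mat t ** ?E" .
    have "invertible ?E"
      using tbc(2,3) assms(1) inv
      by (intro invertible_mult invertible_diag_matrix) (auto simp: diag_tuple_def power_0_left)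
    from proj_class_mult_scalar[OF tbc(1) this] have "h = proj_class ?E"
      by (simp only: A(1) AE)
    then show "h \<in> ?f ` R" using tbc(2,3) by (auto simp: R_def)
  qed
  moreover have "finite R" "card R \<le> d * (d - 1)"
    using card_nth_roots_of_unity_le[where 'a = 'k] assms(1)
    by (simp_all add: R_def card_cartesian_product mult_le_mono)
  ultimately have "finite (carrier (curve_Aut F))" "card (carrier (curve_Aut F)) \<le> d * (d - 1)"
    using finite_subset[of _ "?f ` R"] card_mono[of "?f ` R"] card_image_le[of R ?f]
    by (simp, meson finite_imageI le_trans)
  then show "cyclic_group (curve_Aut F)" "order (curve_Aut F) = d * (d - 1)"
    using group.cyclic_group_if_ord_ge[OF group_curve_Aut _ g(1)] g(2) by simp_all
qed

section \<open>Curves with an automorphism of large order\<close>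

text \<open>The variables \<open>i\<close>, \<open>j\<close>, \<open>m\<close> are renamed to
  \<open>X\<close>, \<open>Y\<close>, \<open>Z\<close>, and \<open>Y\<close> is scaled by
  \<open>t\<close> with \<open>t ^ d = p / q\<close> so that the two pure powers get the same
  coefficient \<open>p\<close>. This leaves \<open>\<alpha> = r / p\<close>.\<close>

lemma proj_equivalent_homology_form:
  fixes F :: "'k::{alg_closed_field, field_char_0} poly3"
  assumes "d \<ge> 4"
    and ijm: "\<forall>x. x = i \<or> x = j \<or> x = m" "i \<noteq> j" "i \<noteq> m" "j \<noteq> m"
    and keys: "Poly_Mapping.keys F = {Poly_Mapping.single i d, Poly_Mapping.single j d,
      Poly_Mapping.single i 1 + Poly_Mapping.single m (d - 1)}"
  shows "\<exists>\<alpha>. \<alpha> \<noteq> 0 \<and> proj_equivalent F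
    (Var3 1 ^ d + Var3 2 ^ d + Const3 \<alpha> * Var3 1 * Var3 3 ^ (d - 1))"
proof -
  let ?mi = "Poly_Mapping.single i d" and ?mj = "Poly_Mapping.single j d"
    and ?mm = "Poly_Mapping.single i 1 + Poly_Mapping.single m (d - 1)"
  define p q r where "p = Poly_Mapping.lookup F ?mi" and "q = Poly_Mapping.lookup F ?mj"
    and "r = Poly_Mapping.lookup F ?mm"
  have nz: "p \<noteq> 0" "q \<noteq> 0" "r \<noteq> 0"
    using keys by (simp_all add: p_def q_def r_def flip: in_keys_iff)
  \<comment> \<open>The exponents of the variable \<open>i\<close> are \<open>d\<close>, 0 and 1,
    which tells the three monomials apart.\<close>
  have "Poly_Mapping.lookup ?mi i \<noteq> Poly_Mapping.lookup ?mj i"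
    "Poly_Mapping.lookup ?mi i \<noteq> Poly_Mapping.lookup ?mm i"
    "Poly_Mapping.lookup ?mj i \<noteq> Poly_Mapping.lookup ?mm i"
    using assms(1) ijm(2-4) by (simp_all add: lookup_add lookup_single when_def)
  then have dist: "?mi \<noteq> ?mj" "?mi \<noteq> ?mm" "?mj \<noteq> ?mm" by metis+
  have F: "F = Const3 p * Var3 i ^ d + Const3 q * Var3 j ^ d + Const3 r * (Var3 i * Var3 m ^ (d - 1))"
  proof -
    have "F = Poly_Mapping.single ?mi p + Poly_Mapping.single ?mj q + Poly_Mapping.single ?mm r"
      using dist by (subst Const3.poly3_as_sum[of F], unfold keys) (simp add: p_def q_def r_def)
    also have "\<dots> = Const3 p * Var3 i ^ d + Const3 q * Var3 j ^ d + Const3 r * (Var3 i * Var3 m ^ (d - 1))"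
      unfolding Var3_power Const3_def by (simp add: Var3_def mult_single)
    finally show ?thesis .
  qed
  obtain t where t: "t ^ d = p / q" using nth_root_exists[of d "p / q"] assms(1) by auto
  have t0: "t \<noteq> 0" using t nz assms(1) by (auto simp: power_0_left)
  define A :: "'k^3^3" where "A = (\<chi> x y. if x = i then (if y = 1 then 1 else 0)
    else if x = j then (if y = 2 then t else 0) else (if y = 3 then 1 else 0))"
  define B :: "'k^3^3" where "B = (\<chi> y x. if y = 1 then (if x = i then 1 else 0)
    else if y = 2 then (if x = j then inverse t else 0) else (if x = m then 1 else 0))"
  have "A ** B = mat 1"
    using ijm(2-4) ijm(1)[rule_format] t0 by (auto simp: vec_eq_iff matrix_matrix_mult_def mat_def sum_3 A_def B_def)
  then have "invertible A" by (auto simp: invertible_right_inverse)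
  moreover have "linear_subst A F = Const3 p * (Var3 1 ^ d + Var3 2 ^ d
      + Const3 (r / p) * Var3 1 * Var3 3 ^ (d - 1))"
  proof -
    have v: "linear_subst A (Var3 i) = Var3 1" "linear_subst A (Var3 j) = Const3 t * Var3 2"
      "linear_subst A (Var3 m) = Var3 3"
      using ijm by (simp_all add: linear_subst_Var3 A_def sum_3 Const3.h_0 Const3.h_1)
    have "Const3 q * Const3 (t ^ d) = Const3 p" "Const3 p * Const3 (r / p) = Const3 r"
      using nz by (simp_all add: t flip: Const3.h_mult)
    then show ?thesis
      unfolding F linear_subst_add linear_subst_mul linear_subst_power linear_subst_Const3 v
        power_mult_distrib Const3_power distrib_left mult.assoc[symmetric]
      by simp
  qed
  ultimately show ?thesis
    using nz unfolding proj_equivalent_def by (intro exI[of _ "r / p"]) auto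
qed

lemma prod_powers_lookup_single:
  fixes a :: "3 \<Rightarrow> 'a::comm_ring_1"
  shows "(\<Prod>x\<in>UNIV. a x ^ Poly_Mapping.lookup (Poly_Mapping.single i k) x) = a i ^ k"
proof -
  have "(\<Prod>x\<in>UNIV. a x ^ Poly_Mapping.lookup (Poly_Mapping.single i k) x)
      = (\<Prod>x\<in>UNIV. if x = i then a x ^ k else 1)"
    by (intro prod.cong) (auto simp: lookup_single when_def)
  then show ?thesis by simp
qed

text \<open>\<open>exponent_cases\<close> finds the three monomials of the normal form in
  \<open>H\<close>, and primitivity of the ratios \<open>b\<close> and \<open>c\<close> excludes all
  others.\<close>

lemma ex_homology_form_if_ord:
  fixes F :: "'k::{alg_closed_field, field_char_0} poly3"
  assumes "d \<ge> 4" "plane_curve d F" "nonsingular_curve F"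
    and g: "g \<in> carrier (curve_Aut F)" "group.ord (curve_Aut F) g = d * (d - 1)"
  shows "\<exists>\<alpha>. \<alpha> \<noteq> 0 \<and> proj_equivalent F
    (Var3 1 ^ d + Var3 2 ^ d + Const3 \<alpha> * Var3 1 * Var3 3 ^ (d - 1))"
proof -
  interpret group "curve_Aut F" by (rule group_curve_Aut)
  define n where "n = d * (d - 1)"
  have "n > 0" using assms(1) by (simp add: n_def)
  obtain A where A: "g = proj_class A" "invertible A" "preserves_form F A"
    using g(1) by (auto simp: carrier_curve_Aut)
  obtain l where l: "l \<noteq> 0" "linear_subst A F = Const3 l * F"
    using A(3) by (auto simp: preserves_form_def)
  have pow: "A [^]\<^bsub>GL3\<^esub> N \<in> scalars3 \<longleftrightarrow> n dvd N" for N :: nat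
    using pow_eq_id[OF g(1), of N] g(2) unfolding A(1) proj_class_pow_eq_one_iff[OF A(2)] n_def by simp
  from this[of n] have "\<exists>s. s \<noteq> 0 \<and> (\<forall>v. ((*v) A ^^ n) v = s *s v)"
    unfolding pow_GL3_in_scalars3_iff by simp
  then obtain s where s: "s \<noteq> 0" "\<And>v. ((*v) A ^^ n) v = s *s v" by blast
  from ex_eigenbasis[OF \<open>n > 0\<close> s]
  obtain P :: "'k^3^3" and a
    where P: "invertible P" and "\<forall>i. A *v column i P = a i *s column i P" .
  then have ev: "\<And>i. A *v column i P = a i *s column i P" by blast
  have AP: "A ** P = P ** diag_matrix a" using ev by (simp add: mult_diag_matrix_eq_iff)
  have nz: "a i \<noteq> 0" for i
  proof
    assume "a i = 0"
    then have "A *v column i P = 0" by (simp add: ev)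
    moreover obtain B where "B ** A = mat 1" using A(2) by (auto simp: invertible_def)
    ultimately have "column i P = 0"
      by (metis matrix_vector_mul_assoc matrix_vector_mul_lid matrix_vector_mult_0_right)
    then show False using column_nonzero[OF P] by blast
  qed
  define H where "H = linear_subst P F"
  have hom: "homogeneous3 d H"
    using assms(2) by (auto simp: H_def plane_curve_def intro: homogeneous3_linear_subst)
  have nonsing: "nonsingular_curve H"
    using assms(3) P by (simp add: H_def nonsingular_curve_linear_subst)
  \<comment> \<open>By \<open>AP\<close>, substituting first \<open>P\<close> and then the diagonal
    matrix into \<open>F\<close> is substituting first \<open>A\<close> and then
    \<open>P\<close>.\<close>
  have "linear_subst (diag_matrix a) H = Const3 l * H"
    by (simp add: H_def linear_subst_mult l linear_subst_Const3_mult flip: AP)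
      (simp add: l linear_subst_Const3_mult flip: linear_subst_mult)
  then have scale: "(\<Prod>i\<in>UNIV. a i ^ Poly_Mapping.lookup x i) * Poly_Mapping.lookup H x
      = l * Poly_Mapping.lookup H x" for x
    by (metis lookup_linear_subst_diag lookup_Const3_mult)
  have char: "(\<Prod>i\<in>UNIV. a i ^ Poly_Mapping.lookup x i) = l" if "x \<in> Poly_Mapping.keys H" for x
    using that scale[of x] by (simp add: in_keys_iff)
  define M where "M i j \<longleftrightarrow>
    Poly_Mapping.single i (d - 1) + Poly_Mapping.single j 1 \<in> Poly_Mapping.keys H" for i j
  have ex: "\<exists>j. M i j" for i
    using nonsingular_curve_lookup[OF hom nonsing, of i] assms(1) by (auto simp: M_def in_keys_iff)
  have R: "a i ^ (d - 1) * a j = l" if "M i j" for i j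
    using char[OF that[unfolded M_def]]
    by (simp add: lookup_add power_add prod.distrib prod_powers_lookup_single)
  have ord: "(d - 1) * ((d - 1) + 1) dvd N" if "N > 0" "\<And>i j. a i ^ N = a j ^ N" for N
    using that pow[of N] assms(1) unfolding pow_eigenbasis_in_scalars3_iff[OF P ev nz] n_def
    by (simp add: mult.commute)
  have "d - 1 \<ge> 3" using assms(1) by simp
  from exponent_cases[OF this nz ex R ord]
  obtain i j m where ijm: "\<forall>x. x = i \<or> x = j \<or> x = m" "i \<noteq> j" "i \<noteq> m" "j \<noteq> m"
    and M: "M i i" "M j j" "M m i" .
  have ad: "a x ^ d = l" if "M x x" for x
    using R[OF that] assms(1) by (simp add: power_eq_if mult.commute)
  define b c where "b = a j / a i" and "c = a m / a i"
  have bc1: "b ^ d = 1" "c ^ (d - 1) = 1"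
  proof -
    show "b ^ d = 1" using ad[OF M(1)] ad[OF M(2)] l(1) by (simp add: b_def power_divide)
    have "a m ^ (d - 1) = a i ^ (d - 1)" using R[OF M(3)] R[OF M(1)] nz[of i] by (metis mult_right_cancel)
    then show "c ^ (d - 1) = 1" using nz by (simp add: c_def power_divide)
  qed
  have "d * (d - 1) dvd N" if "N > 0" "b ^ N = 1" "c ^ N = 1" for N
  proof -
    have "a x ^ N = a i ^ N" for x
      using ijm(1)[rule_format, of x] that(2,3) nz[of i] by (auto simp: b_def c_def power_divide)
    then have "a x ^ N = a y ^ N" for x y by metis
    then show ?thesis using ord[OF that(1)] assms(1) by (simp add: mult.commute)
  qed
  then have prim: "primitive_root_of_unity d b" "primitive_root_of_unity (d - 1) c"
    using primitive_roots_of_unityI[OF _ _ bc1] assms(1) by auto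
  have co: "coprime d (d - 1)"
    using assms(1) by (metis Suc_diff_1 coprime_Suc_left_nat less_le_trans zero_less_numeral)
  have UN: "UNIV = {i, j, m}" using ijm(1) by auto
  have "x \<in> {Poly_Mapping.single i d, Poly_Mapping.single j d,
      Poly_Mapping.single i 1 + Poly_Mapping.single m (d - 1)}" if x: "x \<in> Poly_Mapping.keys H" for x
  proof -
    define u v w where "u = Poly_Mapping.lookup x i" and "v = Poly_Mapping.lookup x j"
      and "w = Poly_Mapping.lookup x m"
    have deg: "u + v + w = d"
      using hom x ijm(2-4) by (auto simp: homogeneous3_def UN u_def v_def w_def)
    have "a i ^ u * a j ^ v * a m ^ w = a i ^ d"
      using char[OF x] ad[OF M(1)] ijm(2-4) by (simp add: UN u_def v_def w_def mult.assoc)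
    \<comment> \<open>Division by \<open>a i ^ d\<close>, where
      \<open>d = u + v + w\<close>.\<close>
    then have "b ^ v * c ^ w = 1"
      using nz by (simp add: b_def c_def power_divide power_add flip: deg)
    then have dvd: "d dvd v" "(d - 1) dvd w"
      using primitive_root_of_unity_mult_eq_1[OF prim co] by auto
    have x_eq: "x = Poly_Mapping.single i u + Poly_Mapping.single j v + Poly_Mapping.single m w"
    proof (rule poly_mapping_eqI)
      fix y show "Poly_Mapping.lookup x y = Poly_Mapping.lookup
          (Poly_Mapping.single i u + Poly_Mapping.single j v + Poly_Mapping.single m w) y"
        using ijm(1)[rule_format, of y] ijm(2-4)
        by (auto simp: lookup_add lookup_single when_def u_def v_def w_def)
    qed
    \<comment> \<open>Divisibility and \<open>v, w \<le> d\<close> leave \<open>v\<close> in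
      \<open>{0, d}\<close> and \<open>w\<close> in \<open>{0, d - 1}\<close>, as
      \<open>2 * (d - 1) > d\<close>.\<close>
    show ?thesis
    proof (cases "v = 0")
      case False
      then have "v = d" using dvd(1) deg by (auto dest: dvd_imp_le)
      then show ?thesis using x_eq deg by simp
    next
      case v: True
      show ?thesis
      proof (cases "w = 0")
        case True
        then show ?thesis using x_eq deg v by simp
      next
        case False
        obtain k where k: "w = (d - 1) * k" using dvd(2) by blast
        have "k = 1"
        proof (rule ccontr)
          assume "k \<noteq> 1"
          then have "k \<ge> 2" using False k by (cases k) auto
          then have "(d - 1) * 2 \<le> w" unfolding k by (rule mult_le_mono2)
          then show False using deg assms(1) by linarith
        qed
        then have "w = d - 1" using k by simp
        moreover from this have "u = 1" using deg v assms(1) by simp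
        ultimately show ?thesis using x_eq v by simp
      qed
    qed
  qed
  moreover have "Poly_Mapping.single i d \<in> Poly_Mapping.keys H" "Poly_Mapping.single j d \<in> Poly_Mapping.keys H"
    "Poly_Mapping.single i 1 + Poly_Mapping.single m (d - 1) \<in> Poly_Mapping.keys H"
    using M assms(1) unfolding M_def by (simp_all add: add.commute flip: single_add)
  ultimately have "Poly_Mapping.keys H = {Poly_Mapping.single i d, Poly_Mapping.single j d,
      Poly_Mapping.single i 1 + Poly_Mapping.single m (d - 1)}"
    by blast
  from proj_equivalent_homology_form[OF assms(1) ijm this]
  obtain \<alpha> B p where "\<alpha> \<noteq> 0" "invertible B" "p \<noteq> 0" and B: "linear_subst B H
      = Const3 p * (Var3 1 ^ d + Var3 2 ^ d + Const3 \<alpha> * Var3 1 * Var3 3 ^ (d - 1))"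
    unfolding proj_equivalent_def by blast
  moreover have "linear_subst (P ** B) F = linear_subst B H"
    by (simp add: H_def linear_subst_mult)
  ultimately show ?thesis
    using P invertible_mult unfolding proj_equivalent_def by metis
qed

theorem proposition36:
  fixes F :: "'k::{alg_closed_field, field_char_0} poly3" and d :: nat
  assumes "d \<ge> 4" and "plane_curve d F" and "nonsingular_curve F"
  shows "((\<exists>g\<in>carrier (curve_Aut F). group.ord (curve_Aut F) g = d * (d - 1)) \<longleftrightarrow>
          (\<exists>\<alpha>. \<alpha> \<noteq> 0 \<and> proj_equivalent F
             (Var3 1 ^ d + Var3 2 ^ d + Const3 \<alpha> * Var3 1 * Var3 3 ^ (d - 1))))
       \<and> (d \<ge> 5 \<and> (\<exists>\<alpha>. \<alpha> \<noteq> 0 \<and> proj_equivalent F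
             (Var3 1 ^ d + Var3 2 ^ d + Const3 \<alpha> * Var3 1 * Var3 3 ^ (d - 1)))
          \<longrightarrow> cyclic_group (curve_Aut F) \<and> order (curve_Aut F) = d * (d - 1))"
proof (intro conjI impI iffI)
  assume "\<exists>g\<in>carrier (curve_Aut F). group.ord (curve_Aut F) g = d * (d - 1)"
  then show "\<exists>\<alpha>. \<alpha> \<noteq> 0 \<and> proj_equivalent F
      (Var3 1 ^ d + Var3 2 ^ d + Const3 \<alpha> * Var3 1 * Var3 3 ^ (d - 1))"
    using ex_homology_form_if_ord[OF assms] by blast
next
  assume "\<exists>\<alpha>. \<alpha> \<noteq> 0 \<and> proj_equivalent F
      (Var3 1 ^ d + Var3 2 ^ d + Const3 \<alpha> * Var3 1 * Var3 3 ^ (d - 1))"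
  then obtain \<alpha> P p Q where P: "linear_subst P F
      = Const3 p * (Var3 1 ^ d + Var3 2 ^ d + Const3 \<alpha> * Var3 1 * Var3 3 ^ (d - 1))"
    "p \<noteq> 0" "P ** Q = mat 1" "Q ** P = mat 1"
    unfolding proj_equivalent_def invertible_def by blast
  \<comment> \<open>The witness is the diagonal matrix with entries 1, \<open>b\<close>,
    \<open>c\<close>, moved to the coordinates of \<open>F\<close> by \<open>P\<close>.\<close>
  obtain b c :: 'k where "primitive_root_of_unity d b" "primitive_root_of_unity (d - 1) c"
    using ex_primitive_root_of_unity[of d] ex_primitive_root_of_unity[of "d - 1"] assms(1) by auto
  then show "\<exists>g\<in>carrier (curve_Aut F). group.ord (curve_Aut F) g = d * (d - 1)"
    using proj_class_diag_ord[OF _ P] assms(1) by fastforce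
next
  assume "d \<ge> 5 \<and> (\<exists>\<alpha>. \<alpha> \<noteq> 0 \<and> proj_equivalent F
      (Var3 1 ^ d + Var3 2 ^ d + Const3 \<alpha> * Var3 1 * Var3 3 ^ (d - 1)))"
  then obtain \<alpha> P p Q where "d \<ge> 5" "\<alpha> \<noteq> 0" and P: "linear_subst P F
      = Const3 p * (Var3 1 ^ d + Var3 2 ^ d + Const3 \<alpha> * Var3 1 * Var3 3 ^ (d - 1))"
    "p \<noteq> 0" "P ** Q = mat 1" "Q ** P = mat 1"
    unfolding proj_equivalent_def invertible_def by blast
  then show "cyclic_group (curve_Aut F)" "order (curve_Aut F) = d * (d - 1)"
    using curve_Aut_cyclic[OF _ _ P] by blast+
qed

end
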